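(* The tautological orbitope $\mathrm{conv}(SO(n))\subset\mathbb{R}^{n\times n}$ of $SO(n)$ has precisely two orbits of facets. These are (up to isomorphism) the tautological orbitopes for $SO(n-1)$ and the free spectrahedra of dimension $\binom{n+1}{2}-1$.
   Context: $\mathrm{conv}(SO(n))$ is the convex hull of the group $SO(n)$ of $n\times n$ rotation matrices inside the space $\mathbb{R}^{n\times n}$ of all real $n\times n$ matrices; likewise the tautological orbitope for $SO(n-1)$ is $\mathrm{conv}(SO(n-1))\subset\mathbb{R}^{(n-1)\times(n-1)}$. Orbits are taken under the action of $SO(n)\times SO(n)$ by left and right multiplication, $(g,h)\cdot A=gAh^T$. A face of a convex body $K$ is a closed convex subset of $K$ containing the two endpoints of any open segment in $K$ that it intersects; a facet is an inclusion-maximal proper face. The free spectrahedron of dimension $\binom{n+1}{2}-1$ is the set of positive semidefinite real symmetric $n\times n$ matrices with trace $1$.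
   Formalization: The formal theorem assumes n ≥ 4: for n = 1, 2, 3 the orbitope conv(SO(n)) (a point, a disc, the 4×4 psd trace-one matrices) has only one orbit of facets, so "precisely two orbits" fails there. *)

theory Defs
  imports "HOL-Analysis.Analysis"
begin

definition SO_group :: "(real^'n^'n) set" where
  "SO_group = {A. rotation_matrix A}"

definition tautological_orbitope :: "(real^'n^'n) set" where
  "tautological_orbitope = convex hull SO_group"

definition SO_SO_act :: "real^'n^'n \<Rightarrow> real^'n^'n \<Rightarrow> real^'n^'n \<Rightarrow> real^'n^'n" where
  "SO_SO_act g h A = g ** A ** transpose h"

definition SO_SO_orbit :: "(real^'n^'n) set \<Rightarrow> (real^'n^'n) set set" where
  "SO_SO_orbit F = {SO_SO_act g h ` F |g h. g \<in> SO_group \<and> h \<in> SO_group}"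

definition proper_face :: "'a::euclidean_space set \<Rightarrow> 'a set \<Rightarrow> bool" where
  "proper_face F K \<longleftrightarrow> closed F \<and> F face_of K \<and> F \<noteq> K"

text \<open>
  Facets are inclusion-maximal proper faces. This is not the library's \<open>facet_of\<close>, which
  demands codimension one: the facets of this orbitope have larger codimension.
\<close>
definition maximal_facet :: "'a::euclidean_space set \<Rightarrow> 'a set \<Rightarrow> bool" where
  "maximal_facet F K \<longleftrightarrow>
     proper_face F K \<and> (\<forall>G. proper_face G K \<and> F \<subseteq> G \<longrightarrow> G = F)"

definition facet_orbits :: "(real^'n^'n) set set set" where
  "facet_orbits = {SO_SO_orbit F |F. maximal_facet F tautological_orbitope}"

definition positive_semidefinite :: "real^'n^'n \<Rightarrow> bool" where
  "positive_semidefinite A \<longleftrightarrow> transpose A = A \<and> (\<forall>x. 0 \<le> x \<bullet> (A *v x))"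

definition free_spectrahedron :: "(real^'n^'n) set" where
  "free_spectrahedron = {A. positive_semidefinite A \<and> trace A = 1}"

text \<open>
  Isomorphism of convex sets living in possibly different spaces: a bijection that is the
  restriction of an affine map. An affine map that is injective on a convex set is injective on
  its affine hull, so this agrees with affine isomorphism of the affine hulls.
\<close>
definition affinely_isomorphic :: "'a::real_vector set \<Rightarrow> 'b::real_vector set \<Rightarrow> bool" where
  "affinely_isomorphic S T \<longleftrightarrow> (\<exists>f c. linear f \<and> bij_betw (\<lambda>x. f x + c) S T)"

end

theory Submission
  imports Defs
begin

text \<open>
  Write \<open>K\<close> for the orbitope of \<open>SO(n)\<close> and \<open>A \<bullet> B\<close> for the Frobenius inner product. Two families of
  linear functionals cut out the facets. For unit vectors \<open>u\<close>, \<open>v\<close> the functional \<open>u \<bullet> A v\<close> is at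
  most \<open>1\<close> on \<open>K\<close>, and its face is the hull of the rotations with \<open>g v = u\<close>. For an orthogonal matrix
  \<open>R\<close> of determinant \<open>-1\<close> the functional \<open>R \<bullet> A\<close> is at most \<open>n - 2\<close> on \<open>K\<close>: for a rotation \<open>g\<close> the matrix
  \<open>h = g (transpose R)\<close> has determinant \<open>-1\<close>, hence the eigenvalue \<open>-1\<close>, hence trace at most
  \<open>n - 2\<close>, with equality exactly for reflections (\<open>trace_orthogonal_det_minus_1\<close>). The face of
  \<open>R\<close> is therefore the hull of the matrices \<open>(1 - 2 w w\<^sup>T) R\<close> with \<open>w\<close> a unit vector.

  Every proper face lies in one of these (\<open>proper_face_subset\<close>). It is contained in the exposed
  face of some functional \<open>C \<noteq> 0\<close>. Translating a rotation that maximises \<open>C\<close> to the identity makes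
  \<open>C\<close> symmetric and makes the sum of any two of its eigenvalues nonnegative, by comparison of the
  identity with products of two reflections (\<open>maximal_at_identity\<close>). So at most one eigenvalue is
  negative, and the spectral decomposition exhibits \<open>C\<close> as a nonnegative combination of functionals
  \<open>u \<bullet> A v\<close> and at most one functional \<open>R \<bullet> A\<close>, all of which attain their maxima at the same
  rotation (\<open>exposed_face_subset\<close>). A point maximising \<open>C\<close> maximises each functional occurring with
  a positive coefficient.

  For \<open>n \<ge> 4\<close> there are no proper inclusions among these faces, which makes all of them maximal
  (\<open>maximal_facet_orbitope_iff\<close>). Each family is a single orbit: \<open>SO(n)\<close> acts transitively on the unit
  sphere and on the orthogonal matrices of determinant \<open>-1\<close>. The face of \<open>u = v\<close> equal to a
  coordinate vector is the orbitope of the rotations of the remaining coordinates. The face of \<open>R\<close>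
  is carried by an affine map to the hull of the rank-one projections \<open>w w\<^sup>T\<close>, which is the free
  spectrahedron by the spectral theorem. The same theorem shows that the free spectrahedron spans
  the space of symmetric matrices, and it lies in a hyperplane missing the origin; this gives its
  dimension.
\<close>

section \<open>Rank-one matrices and the Frobenius inner product\<close>

definition outer :: "real^'n \<Rightarrow> real^'m \<Rightarrow> real^'m^'n" where
  "outer u v = (\<chi> i j. u $ i * v $ j)"

lemma outer_mult_vector: "outer u v *v x = (v \<bullet> x) *\<^sub>R u"
  by (simp add: outer_def vec_eq_iff matrix_vector_mult_def inner_vec_def sum_distrib_left mult_ac)

lemma transpose_outer: "transpose (outer u v) = outer v u"
  by (simp add: outer_def transpose_def vec_eq_iff)

lemma inner_outer: "outer u v \<bullet> A = u \<bullet> (A *v v)"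
  by (simp add: outer_def matrix_vector_mult_def inner_vec_def sum_distrib_left mult_ac)

lemma inner_mat_1: "mat 1 \<bullet> A = trace A"
  by (simp add: inner_vec_def mat_def trace_def if_distrib if_distribR cong: if_cong)

lemma inner_transpose: "transpose A \<bullet> transpose B = A \<bullet> (B :: real^'n^'m)"
  unfolding inner_vec_def transpose_def by simp (rule sum.swap)

lemma inner_matrix_mult_left: "(A ** B) \<bullet> C = B \<bullet> (transpose A ** C)"
  for A :: "real^'k^'m" and B :: "real^'n^'k"
proof -
  have "(A ** B) \<bullet> C = (\<Sum>i\<in>UNIV. \<Sum>j\<in>UNIV. \<Sum>k\<in>UNIV. A$i$k * B$k$j * C$i$j)"
    by (simp add: inner_vec_def matrix_matrix_mult_def sum_distrib_right)
  also have "\<dots> = (\<Sum>i\<in>UNIV. \<Sum>k\<in>UNIV. \<Sum>j\<in>UNIV. A$i$k * B$k$j * C$i$j)"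
    by (intro sum.cong refl) (rule sum.swap)
  also have "\<dots> = (\<Sum>k\<in>UNIV. \<Sum>i\<in>UNIV. \<Sum>j\<in>UNIV. A$i$k * B$k$j * C$i$j)"
    by (rule sum.swap)
  also have "\<dots> = (\<Sum>k\<in>UNIV. \<Sum>j\<in>UNIV. \<Sum>i\<in>UNIV. A$i$k * B$k$j * C$i$j)"
    by (intro sum.cong refl) (rule sum.swap)
  also have "\<dots> = B \<bullet> (transpose A ** C)"
    by (simp add: inner_vec_def matrix_matrix_mult_def transpose_def sum_distrib_left mult_ac)
  finally show ?thesis .
qed

lemma inner_matrix_mult_right: "(A ** B) \<bullet> C = A \<bullet> (C ** transpose B)"
  for A :: "real^'k^'m" and B :: "real^'n^'k"
  using inner_matrix_mult_left[of "transpose B" "transpose A" "transpose C"]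
  by (metis inner_transpose matrix_transpose_mul transpose_transpose)

lemma inner_matrix_vector_mult: "(A *v x) \<bullet> y = x \<bullet> (transpose A *v y)" for A :: "real^'n^'m"
  by (metis dot_lmul_matrix inner_commute transpose_matrix_vector)

lemma matrix_mult_outer: "A ** outer u v = outer (A *v u) v" for A :: "real^'n^'m"
  by (simp add: outer_def vec_eq_iff matrix_matrix_mult_def matrix_vector_mult_def sum_distrib_right
      sum_distrib_left mult_ac)

lemma outer_matrix_mult: "outer u v ** A = outer u (transpose A *v v)" for A :: "real^'n^'m"
  by (simp add: outer_def vec_eq_iff matrix_matrix_mult_def matrix_vector_mult_def sum_distrib_left
      transpose_def mult_ac del: transpose_matrix_vector)

lemma linear_matrix_mult_left: "linear (\<lambda>X. A ** X)" for A :: "real^'n^'m"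
  by (rule linearI) (simp_all add: matrix_add_ldistrib matrix_scalar_ac scalar_matrix_assoc)

lemma linear_matrix_mult_right: "linear (\<lambda>X. X ** A)" for A :: "real^'n^'m"
  by (rule linearI) (simp_all add: matrix_matrix_mult_def vec_eq_iff algebra_simps sum.distrib sum_distrib_left)

lemma linear_matrix_vector_mult_left: "linear (\<lambda>X. X *v v)" for v :: "real^'n"
  by (rule linearI) (simp_all add: algebra_simps scaleR_matrix_vector_assoc)

section \<open>Orthogonal matrices and reflections\<close>

lemma orthogonal_matrixD:
  fixes Q :: "real^'n^'n"
  assumes "orthogonal_matrix Q"
  shows "transpose Q ** Q = mat 1" "Q ** transpose Q = mat 1"
  using assms by (auto simp: orthogonal_matrix_def)

lemma orthogonal_matrix_inner:
  fixes Q :: "real^'n^'n"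
  assumes "orthogonal_matrix Q"
  shows "(Q *v x) \<bullet> (Q *v y) = x \<bullet> y"
  by (metis assms inner_matrix_vector_mult matrix_vector_mul_assoc matrix_vector_mul_lid
      orthogonal_matrixD(1))

lemma orthogonal_matrix_norm: "orthogonal_matrix (Q :: real^'n^'n) \<Longrightarrow> norm (Q *v x) = norm x"
  by (simp add: norm_eq_sqrt_inner orthogonal_matrix_inner)

lemma orthogonal_matrix_cancel:
  fixes Q :: "real^'n^'n"
  assumes "orthogonal_matrix Q"
  shows "transpose Q *v (Q *v x) = x" "Q *v (transpose Q *v x) = x"
  by (metis assms matrix_vector_mul_assoc matrix_vector_mul_lid orthogonal_matrixD)+

lemma inner_orthogonal_matrix: "orthogonal_matrix Q \<Longrightarrow> Q \<bullet> Q = real CARD('n)" for Q :: "real^'n^'n"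
  by (metis inner_mat_1 inner_matrix_mult_right matrix_mul_lid orthogonal_matrixD(2) trace_I)

definition householder :: "real^'n \<Rightarrow> real^'n^'n" where
  "householder v = mat 1 - 2 *\<^sub>R outer v v"

lemma householder_mult_vector: "householder v *v x = x - (2 * (v \<bullet> x)) *\<^sub>R v"
  by (simp add: householder_def algebra_simps outer_mult_vector flip: scaleR_matrix_vector_assoc)

lemma transpose_householder [simp]: "transpose (householder v) = householder v"
  by (auto simp: householder_def transpose_def outer_def mat_def vec_eq_iff mult.commute)

lemma householder_square: "norm v = 1 \<Longrightarrow> householder v ** householder v = mat 1"
  by (simp add: matrix_eq householder_mult_vector inner_diff_right norm_eq_1
      flip: matrix_vector_mul_assoc)

lemma orthogonal_matrix_householder: "norm v = 1 \<Longrightarrow> orthogonal_matrix (householder v)"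
  by (simp add: orthogonal_matrix_def householder_square)

lemma inner_householder: "householder v \<bullet> A = trace A - 2 * (v \<bullet> (A *v v))"
  by (simp add: householder_def inner_diff_left inner_mat_1 inner_outer)

lemma orthogonal_conj_householder:
  assumes "orthogonal_matrix Q"
  shows "Q ** householder v ** transpose Q = householder (Q *v v)"
  using assms
  by (simp add: matrix_eq householder_mult_vector matrix_vector_mult_diff_distrib
      matrix_vector_mult_scaleR orthogonal_matrix_cancel inner_matrix_vector_mult
      del: transpose_matrix_vector flip: matrix_vector_mul_assoc)

lemma det_householder:
  fixes v :: "real^'n"
  assumes "norm v = 1"
  shows "det (householder v) = -1"
proof -
  obtain k :: 'n and Q where Q: "orthogonal_matrix Q" "Q *v axis k 1 = v"
    using orthogonal_matrix_exists_basis[OF assms] by metis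
  let ?H = "householder (axis k 1) :: real^'n^'n"
  have H: "?H $ i $ j = (if i = j then if i = k then -1 else 1 else 0)" for i j
    by (auto simp: householder_def mat_def outer_def axis_def)
  have "det ?H = (\<Prod>i\<in>UNIV. ?H $ i $ i)"
    by (rule det_diagonal) (simp add: H)
  also have "\<dots> = -1"
    by (simp add: H prod.If_cases)
  finally have "det ?H = -1" .
  moreover have "det (householder v) = det Q * det ?H * det (transpose Q)"
    by (metis Q det_mul orthogonal_conj_householder)
  moreover have "det Q * det Q = 1"
    using det_orthogonal_matrix[OF Q(1)] by auto
  ultimately show ?thesis
    by simp
qed

text \<open>An orthogonal matrix \<open>Q\<close> of determinant \<open>-1\<close> has the eigenvalue \<open>-1\<close>, because
  \<open>det (1 + Q) = det Q * det (transpose Q + 1) = - det (1 + Q)\<close>.\<close>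

lemma orthogonal_det_minus_1_eigenvector:
  fixes Q :: "real^'n^'n"
  assumes "orthogonal_matrix Q" "det Q = -1"
  obtains v where "norm v = 1" "Q *v v = - v"
proof -
  have "transpose (mat 1 + Q) = mat 1 + transpose Q"
    by (auto simp: transpose_def vec_eq_iff mat_def)
  hence "Q ** transpose (mat 1 + Q) = mat 1 + Q"
    by (simp add: matrix_add_ldistrib orthogonal_matrixD[OF assms(1)])
  hence "det Q * det (transpose (mat 1 + Q)) = det (mat 1 + Q)"
    unfolding det_mul[symmetric] by (rule arg_cong)
  hence "det (mat 1 + Q) = 0"
    unfolding det_transpose assms(2) by simp
  hence "\<not> invertible (mat 1 + Q)"
    by (simp add: invertible_det_nz)
  then obtain x where x: "x \<noteq> 0" "(mat 1 + Q) *v x = 0"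
    unfolding invertible_left_inverse matrix_left_invertible_ker by blast
  show thesis
  proof
    show "norm (x /\<^sub>R norm x) = 1" using x by simp
    have "Q *v x = - x"
      using x(2) by (simp add: algebra_simps add_eq_0_iff)
    thus "Q *v (x /\<^sub>R norm x) = - (x /\<^sub>R norm x)"
      by (simp add: matrix_vector_mult_scaleR)
  qed
qed

text \<open>With a unit vector \<open>v\<close> such that \<open>h v = - v\<close>, the squared Frobenius distance between \<open>h\<close> and
  \<open>householder v\<close> is \<open>2 * (n - 2 - trace h)\<close>. Its nonnegativity is the bound, its vanishing the case
  of equality.\<close>

lemma trace_orthogonal_det_minus_1:
  fixes h :: "real^'n^'n"
  assumes "orthogonal_matrix h" "det h = -1"
  shows "trace h \<le> real CARD('n) - 2"
    and "trace h = real CARD('n) - 2 \<Longrightarrow> \<exists>v. norm v = 1 \<and> h = householder v"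
proof -
  obtain v where v: "norm v = 1" "h *v v = - v"
    using orthogonal_det_minus_1_eigenvector assms by blast
  have "householder v \<bullet> h = trace h + 2"
    using v by (simp add: inner_householder norm_eq_1)
  moreover have "(norm (h - householder v))\<^sup>2
      = h \<bullet> h + householder v \<bullet> householder v - 2 * (householder v \<bullet> h)"
    by (simp add: power2_norm_eq_inner inner_diff_left inner_diff_right inner_commute)
  ultimately have eq: "(norm (h - householder v))\<^sup>2 = 2 * (real CARD('n) - 2 - trace h)"
    using assms v by (simp add: inner_orthogonal_matrix orthogonal_matrix_householder)
  have "0 \<le> 2 * (real CARD('n) - 2 - trace h)"
    unfolding eq[symmetric] by simp
  thus "trace h \<le> real CARD('n) - 2"
    by simp
  show "\<exists>v. norm v = 1 \<and> h = householder v" if "trace h = real CARD('n) - 2"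
    using eq that v by auto
qed

section \<open>The spectral theorem for real symmetric matrices\<close>

lemma orthogonal_matrix_rows_inner:
  "orthogonal_matrix Q \<longleftrightarrow> (\<forall>i j. Q $ i \<bullet> Q $ j = (if i = j then 1 else 0))"
  for Q :: "real^'n^'n"
proof -
  have "orthogonal_matrix Q \<longleftrightarrow> Q ** transpose Q = mat 1"
    by (metis orthogonal_matrix orthogonal_matrix_transpose transpose_transpose)
  also have "\<dots> \<longleftrightarrow> (\<forall>i j. Q $ i \<bullet> Q $ j = (if i = j then 1 else 0))"
    by (simp add: matrix_mult_transpose_dot_row vec_eq_iff row_def mat_def)
  finally show ?thesis .
qed

lemma compact_orthogonal_matrices: "compact {Q :: real^'n^'n. orthogonal_matrix Q}"
proof (rule compact_eq_bounded_closed[THEN iffD2], intro conjI)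
  show "bounded {Q :: real^'n^'n. orthogonal_matrix Q}"
    by (rule boundedI[of _ "sqrt CARD('n)"]) (simp add: norm_eq_sqrt_inner inner_orthogonal_matrix)
  show "closed {Q :: real^'n^'n. orthogonal_matrix Q}"
    unfolding orthogonal_matrix_rows_inner
    by (intro closed_Collect_all closed_Collect_eq continuous_intros)
qed

lemma orthonormal_frame_sum_outer:
  fixes q :: "'n::finite \<Rightarrow> real^'n"
  assumes "\<And>i j. q i \<bullet> q j = (if i = j then 1 else 0)"
  shows "(\<Sum>i\<in>UNIV. outer (q i) (q i)) = mat 1"
proof -
  define Q where "Q = (\<chi> i. q i)"
  have "orthogonal_matrix Q"
    by (simp add: orthogonal_matrix_rows_inner Q_def assms)
  hence "transpose Q ** Q = mat 1"
    by (rule orthogonal_matrixD)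
  moreover have "transpose Q ** Q = (\<Sum>i\<in>UNIV. outer (q i) (q i))"
    by (simp add: vec_eq_iff matrix_matrix_mult_def transpose_def Q_def outer_def)
  ultimately show ?thesis
    by simp
qed

lemma orthonormal_frame_expansion:
  fixes q :: "'n::finite \<Rightarrow> real^'n"
  assumes "\<And>i j. q i \<bullet> q j = (if i = j then 1 else 0)"
  shows "x = (\<Sum>i\<in>UNIV. (q i \<bullet> x) *\<^sub>R q i)"
proof -
  have "x = (\<Sum>i\<in>UNIV. outer (q i) (q i)) *v x"
    by (simp add: orthonormal_frame_sum_outer assms)
  also have "\<dots> = (\<Sum>i\<in>UNIV. (q i \<bullet> x) *\<^sub>R q i)"
    by (simp add: linear_sum[OF linear_matrix_vector_mult_left] outer_mult_vector)
  finally show ?thesis .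
qed

lemma inner_diagonalized_frame:
  fixes q :: "'n::finite \<Rightarrow> real^'n"
  assumes "\<And>i j. q i \<bullet> q j = (if i = j then 1 else 0)"
  shows "q i \<bullet> ((\<Sum>k\<in>UNIV. d k *\<^sub>R outer (q k) (q k)) *v q i) = d i"
proof -
  have "(\<Sum>k\<in>UNIV. d k *\<^sub>R outer (q k) (q k)) *v q i = (\<Sum>k\<in>UNIV. d k *\<^sub>R (q k \<bullet> q i) *\<^sub>R q k)"
    by (simp add: linear_sum[OF linear_matrix_vector_mult_left] outer_mult_vector
        flip: scaleR_matrix_vector_assoc)
  also have "\<dots> = (\<Sum>k\<in>UNIV. if k = i then d i *\<^sub>R q i else 0)"
    by (rule sum.cong) (auto simp: assms)
  finally show ?thesis
    by (simp add: assms)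
qed

text \<open>For small \<open>s\<close> the left-hand side is of first order and the right-hand side of second order,
  so a nonzero \<open>a\<close> would violate the inequality for small \<open>s\<close> of the sign of \<open>a\<close>. This is the stationarity
  condition at the identity on a circle of plane rotations, used for both maximisation arguments
  below.\<close>

lemma plane_rotation_first_order:
  fixes a b :: real
  assumes "\<And>c s. c\<^sup>2 + s\<^sup>2 = 1 \<Longrightarrow> c * s * a \<le> s\<^sup>2 * b"
  shows "a = 0"
proof -
  \<comment> \<open>\<open>t\<close> is the slope \<open>s / c\<close>, which ranges over all reals.\<close>
  have *: "t * a \<le> t\<^sup>2 * b" for t
  proof -
    define c where "c = 1 / sqrt (1 + t\<^sup>2)"
    have c: "c\<^sup>2 * (1 + t\<^sup>2) = 1"
      by (simp add: c_def power_divide add_nonneg_eq_0_iff)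
    hence "c\<^sup>2 + (t * c)\<^sup>2 = 1"
      by (simp add: algebra_simps)
    from assms[OF this] have "c\<^sup>2 * (t * a) \<le> c\<^sup>2 * (t\<^sup>2 * b)"
      by (simp add: power2_eq_square algebra_simps)
    moreover have "c\<^sup>2 > 0"
      using c by (metis mult_zero_left zero_less_power2 zero_neq_one power2_eq_square)
    ultimately show ?thesis
      by simp
  qed
  \<comment> \<open>The slope \<open>a / B\<close> has the sign of \<open>a\<close> and is small enough for \<open>b / B < 1\<close>.\<close>
  define B where "B = \<bar>b\<bar> + 1"
  have B: "B > 0" "b < B"
    by (auto simp: B_def)
  have "a\<^sup>2 / B \<le> a\<^sup>2 / B * (b / B)"
    using *[of "a / B"] by (simp add: power2_eq_square)
  hence "a\<^sup>2 / B * (1 - b / B) \<le> 0"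
    by (simp add: right_diff_distrib)
  moreover have "1 - b / B > 0"
    using B by simp
  ultimately have "a\<^sup>2 / B \<le> 0"
    by (metis mult_pos_pos not_le)
  thus ?thesis
    using B by (simp add: divide_le_0_iff)
qed

text \<open>Among all orthonormal frames \<open>q\<close>, one maximising \<open>\<Sum>i. w i * (q i \<bullet> A q i)\<close> for pairwise
  distinct weights \<open>w\<close> diagonalises \<open>A\<close>: rotating \<open>q i\<close> and \<open>q j\<close> in their plane changes the value to
  first order by a multiple of \<open>(w i - w j) * (q i \<bullet> A q j)\<close>.\<close>

theorem spectral_theorem:
  fixes A :: "real^'n^'n"
  assumes sym: "transpose A = A"
  obtains q :: "'n \<Rightarrow> real^'n" and d :: "'n \<Rightarrow> real"
  where "\<And>i j. q i \<bullet> q j = (if i = j then 1 else 0)"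
    and "A = (\<Sum>i\<in>UNIV. d i *\<^sub>R outer (q i) (q i))"
proof -
  obtain h :: "'n \<Rightarrow> nat" where "inj h"
    using ex_bij_betw_finite_nat[of "UNIV :: 'n set"] by (auto simp: bij_betw_def)
  define w where "w i = real (h i)" for i
  have w: "w i \<noteq> w j" if "i \<noteq> j" for i j
    using that \<open>inj h\<close> by (auto simp: w_def inj_eq)
  define f where "f X = (\<Sum>k\<in>UNIV. w k * (X $ k \<bullet> (A *v X $ k)))" for X :: "real^'n^'n"
  have "continuous_on {Q :: real^'n^'n. orthogonal_matrix Q} f"
    unfolding f_def matrix_vector_mult_def by (intro continuous_intros)
  moreover have "(mat 1 :: real^'n^'n) \<in> {Q. orthogonal_matrix Q}"
    by (simp add: orthogonal_matrix_id)
  ultimately obtain X where X: "orthogonal_matrix X"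
      and max: "\<And>Y. orthogonal_matrix Y \<Longrightarrow> f Y \<le> f X"
    using continuous_attains_sup[OF compact_orthogonal_matrices, of f] by auto
  define q where "q i = X $ i" for i
  have q: "q i \<bullet> q j = (if i = j then 1 else 0)" for i j
    using X by (simp add: q_def orthogonal_matrix_rows_inner)
  have A_sym: "x \<bullet> (A *v y) = y \<bullet> (A *v x)" for x y
    by (metis sym inner_commute inner_matrix_vector_mult)
  have off: "q i \<bullet> (A *v q j) = 0" if ij: "i \<noteq> j" for i j
  proof -
    define b where "b = q i \<bullet> (A *v q j)"
    have b: "q j \<bullet> (A *v q i) = b"
      by (simp add: b_def A_sym)
    have "c * s * (2 * (w i - w j) * b)
        \<le> s\<^sup>2 * ((w i - w j) * (q i \<bullet> (A *v q i) - q j \<bullet> (A *v q j)))"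
      if cs: "c\<^sup>2 + s\<^sup>2 = 1" for c s
    proof -
      define p r where "p = c *\<^sub>R q i + s *\<^sub>R q j" and "r = c *\<^sub>R q j - s *\<^sub>R q i"
      define Y where "Y = (\<chi> k. if k = i then p else if k = j then r else q k)"
      have "p \<bullet> p = 1" "r \<bullet> r = 1" "p \<bullet> r = 0" "r \<bullet> p = 0"
        using cs ij by (simp_all add: p_def r_def inner_simps q power2_eq_square algebra_simps)
      moreover have "p \<bullet> q k = 0" "r \<bullet> q k = 0" "q k \<bullet> p = 0" "q k \<bullet> r = 0" if "k \<noteq> i" "k \<noteq> j" for k
        using that by (auto simp: p_def r_def inner_simps q)
      ultimately have "orthogonal_matrix Y"
        by (auto simp: orthogonal_matrix_rows_inner Y_def q)
      from max[OF this] have "f Y \<le> f X" .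
      moreover have split: "(\<Sum>k\<in>UNIV. g k) = g i + g j + (\<Sum>k\<in>UNIV - {i, j}. g k)"
        for g :: "'n \<Rightarrow> real"
        using ij by (simp add: sum.remove[of UNIV i] sum.remove[of "UNIV - {i}" j]
            Diff_insert2[of UNIV i "{j}"] insert_commute)
      moreover have "(\<Sum>k\<in>UNIV - {i, j}. w k * (Y $ k \<bullet> (A *v Y $ k)))
          = (\<Sum>k\<in>UNIV - {i, j}. w k * (X $ k \<bullet> (A *v X $ k)))"
        by (rule sum.cong) (auto simp: Y_def q_def)
      ultimately have "w i * (p \<bullet> (A *v p)) + w j * (r \<bullet> (A *v r))
          \<le> w i * (q i \<bullet> (A *v q i)) + w j * (q j \<bullet> (A *v q j))"
        using ij by (simp add: f_def split Y_def q_def)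
      moreover have "p \<bullet> (A *v p)
          = c\<^sup>2 * (q i \<bullet> (A *v q i)) + 2 * c * s * b + s\<^sup>2 * (q j \<bullet> (A *v q j))"
        by (simp add: p_def inner_simps algebra_simps b b_def[symmetric] power2_eq_square)
      moreover have "r \<bullet> (A *v r)
          = s\<^sup>2 * (q i \<bullet> (A *v q i)) - 2 * c * s * b + c\<^sup>2 * (q j \<bullet> (A *v q j))"
        by (simp add: r_def inner_simps algebra_simps b b_def[symmetric] power2_eq_square)
      moreover have "c\<^sup>2 = 1 - s\<^sup>2"
        using cs by simp
      ultimately show ?thesis
        by (simp add: algebra_simps)
    qed
    from plane_rotation_first_order[OF this] show ?thesis
      using w[OF ij] by (simp add: b_def)
  qed
  define d where "d i = q i \<bullet> (A *v q i)" for i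
  have eig: "A *v q i = d i *\<^sub>R q i" for i
  proof -
    have "A *v q i = (\<Sum>k\<in>UNIV. (q k \<bullet> (A *v q i)) *\<^sub>R q k)"
      by (rule orthonormal_frame_expansion) (rule q)
    also have "\<dots> = (\<Sum>k\<in>UNIV. if k = i then d i *\<^sub>R q i else 0)"
      by (rule sum.cong) (auto simp: off d_def)
    finally show ?thesis
      by simp
  qed
  have "A = A ** (\<Sum>i\<in>UNIV. outer (q i) (q i))"
    by (simp add: orthonormal_frame_sum_outer q)
  also have "\<dots> = (\<Sum>i\<in>UNIV. outer (A *v q i) (q i))"
    by (simp add: linear_sum[OF linear_matrix_mult_left] matrix_mult_outer)
  also have "\<dots> = (\<Sum>i\<in>UNIV. d i *\<^sub>R outer (q i) (q i))"
    by (rule sum.cong) (auto simp: eig outer_def vec_eq_iff)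
  finally show ?thesis
    using that q by blast
qed

section \<open>The free spectrahedron\<close>

lemma trace_outer: "trace (outer u v) = u \<bullet> v"
  by (simp add: trace_def outer_def inner_vec_def)

lemma linear_trace: "linear (trace :: real^'n^'n \<Rightarrow> real)"
  by (rule linearI) (simp_all add: trace_def sum.distrib sum_distrib_left)

lemma convex_free_spectrahedron: "convex (free_spectrahedron :: (real^'n^'n) set)"
proof (rule convexI)
  fix A B :: "real^'n^'n" and u v :: real
  assume *: "A \<in> free_spectrahedron" "B \<in> free_spectrahedron" "0 \<le> u" "0 \<le> v" "u + v = 1"
  have "transpose (u *\<^sub>R A + v *\<^sub>R B) = u *\<^sub>R transpose A + v *\<^sub>R transpose B"
    by (simp add: transpose_def vec_eq_iff)
  with * show "u *\<^sub>R A + v *\<^sub>R B \<in> free_spectrahedron"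
    by (simp add: free_spectrahedron_def positive_semidefinite_def linear_add[OF linear_trace]
        linear_scale[OF linear_trace] algebra_simps inner_simps flip: scaleR_matrix_vector_assoc)
qed

text \<open>The spectral decomposition of a positive semidefinite matrix of trace \<open>1\<close> is a convex
  combination: its coefficients are nonnegative and sum to the trace.\<close>

lemma free_spectrahedron_eq_convex_hull:
  "free_spectrahedron = convex hull {outer v v |v :: real^'n. norm v = 1}"
proof (rule antisym)
  show "convex hull {outer v v |v :: real^'n. norm v = 1} \<subseteq> free_spectrahedron"
  proof (rule hull_minimal)
    show "{outer v v |v :: real^'n. norm v = 1} \<subseteq> free_spectrahedron"
      by (auto simp: free_spectrahedron_def positive_semidefinite_def transpose_outer trace_outer
          norm_eq_1 outer_mult_vector inner_commute)
  qed (rule convex_free_spectrahedron)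
next
  show "free_spectrahedron \<subseteq> convex hull {outer v v |v :: real^'n. norm v = 1}"
  proof
    fix A :: "real^'n^'n"
    assume "A \<in> free_spectrahedron"
    hence sym: "transpose A = A" and psd: "\<And>x. 0 \<le> x \<bullet> (A *v x)" and tr: "trace A = 1"
      by (auto simp: free_spectrahedron_def positive_semidefinite_def)
    obtain q :: "'n \<Rightarrow> real^'n" and d where q: "\<And>i j. q i \<bullet> q j = (if i = j then 1 else (0::real))"
      and A: "A = (\<Sum>i\<in>UNIV. d i *\<^sub>R outer (q i) (q i))"
      using spectral_theorem[OF sym] by blast
    have "q i \<bullet> (A *v q i) = d i" for i
      unfolding A by (rule inner_diagonalized_frame) (rule q)
    hence "0 \<le> d i" for i
      using psd[of "q i"] by simp
    moreover have "(\<Sum>i\<in>UNIV. d i) = 1"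
      using tr unfolding A
      by (simp add: linear_sum[OF linear_trace] linear_scale[OF linear_trace] trace_outer q)
    ultimately show "A \<in> convex hull {outer v v |v :: real^'n. norm v = 1}"
      unfolding A
      by (intro convex_sum) (auto intro!: hull_inc simp: norm_eq_1 q)
  qed
qed

text \<open>A basis of the symmetric matrices is indexed by the subsets \<open>{i, j}\<close> with one or two
  elements: the indicator matrix of the positions \<open>(i, j)\<close> and \<open>(j, i)\<close>.\<close>

lemma dim_symmetric_matrices:
  "dim {A :: real^'n^'n. transpose A = A} = (CARD('n) + 1) choose 2"
proof -
  define E :: "'n set \<Rightarrow> real^'n^'n" where "E X = (\<chi> i j. if {i, j} = X then 1 else 0)" for X
  define I :: "'n set set" where "I = {X. \<exists>i j. X = {i, j}}"
  have E_inner: "E X \<bullet> E Y = 0" if "X \<noteq> Y" for X Y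
    using that by (auto simp: E_def inner_vec_def intro!: sum.neutral split: if_splits)
  have E_nz: "E X \<noteq> 0" if "X \<in> I" for X
    using that by (auto simp: E_def I_def vec_eq_iff)
  have inj: "inj_on E I"
    by (rule inj_onI) (metis E_inner E_nz inner_eq_zero_iff)
  have "independent (E ` I)"
    by (rule pairwise_orthogonal_independent)
      (use E_nz in \<open>auto simp: pairwise_def orthogonal_def intro!: E_inner\<close>)
  moreover have "E ` I \<subseteq> {A. transpose A = A}"
    by (auto simp: E_def transpose_def insert_commute)
  moreover have "{A. transpose A = A} \<subseteq> span (E ` I)"
  proof clarify
    fix A :: "real^'n^'n"
    assume sym: "transpose A = A"
    \<comment> \<open>\<open>a {i, j}\<close> is the common value of the entries at \<open>(i, j)\<close> and \<open>(j, i)\<close>.\<close>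
    define a where "a X = (THE x. \<forall>i j. X = {i, j} \<longrightarrow> x = A $ i $ j)" for X
    have A_sym: "A $ i $ j = A $ j $ i" for i j
    proof -
      have "transpose A $ i $ j = A $ j $ i"
        by (simp add: transpose_def)
      thus ?thesis
        by (simp add: sym)
    qed
    have a: "a {i, j} = A $ i $ j" for i j
      unfolding a_def
    proof (rule the_equality)
      show "\<forall>i' j'. {i, j} = {i', j'} \<longrightarrow> A $ i $ j = A $ i' $ j'"
        by (metis A_sym doubleton_eq_iff)
    qed blast
    have "A = (\<Sum>X\<in>I. a X *\<^sub>R E X)"
    proof -
      have "(\<Sum>X\<in>I. a X *\<^sub>R E X) $ i $ j = A $ i $ j" for i j
      proof -
        have "(\<Sum>X\<in>I. a X *\<^sub>R E X) $ i $ j = (\<Sum>X\<in>I. if X = {i, j} then a X else 0)"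
          unfolding sum_component by (rule sum.cong) (auto simp: E_def)
        also have "\<dots> = A $ i $ j"
          by (subst sum.delta) (auto simp: I_def a)
        finally show ?thesis .
      qed
      thus ?thesis
        by (simp add: vec_eq_iff)
    qed
    also have "\<dots> \<in> span (E ` I)"
      by (intro span_sum span_scale span_base imageI)
    finally show "A \<in> span (E ` I)" .
  qed
  moreover have "card (E ` I) = (CARD('n) + 1) choose 2"
  proof -
    have "I = {X. card X = 1} \<union> {X. card X = 2}"
      by (auto simp: I_def card_1_singleton_iff card_2_iff card_insert_if)
    hence "card I = card {X :: 'n set. card X = 1} + card {X :: 'n set. card X = 2}"
      by (simp, subst card_Un_disjoint) auto
    also have "\<dots> = (CARD('n) choose 1) + (CARD('n) choose 2)"
      using n_subsets[of "UNIV :: 'n set"] by simp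
    also have "\<dots> = (CARD('n) + 1) choose 2"
      by (simp add: numeral_2_eq_2)
    finally show ?thesis
      using inj by (simp add: card_image)
  qed
  ultimately show ?thesis
    by (intro dim_unique) auto
qed

text \<open>The spectral theorem writes every symmetric matrix as a linear combination of points of the
  free spectrahedron.\<close>

lemma span_free_spectrahedron:
  "span free_spectrahedron = {A :: real^'n^'n. transpose A = A}"
proof (rule antisym)
  show "span free_spectrahedron \<subseteq> {A :: real^'n^'n. transpose A = A}"
    by (rule span_minimal)
      (auto simp: free_spectrahedron_def positive_semidefinite_def subspace_def transpose_def
        vec_eq_iff)
  show "{A :: real^'n^'n. transpose A = A} \<subseteq> span free_spectrahedron"
  proof clarify
    fix A :: "real^'n^'n"
    assume sym: "transpose A = A"
    obtain q :: "'n \<Rightarrow> real^'n" and d where q: "\<And>i j. q i \<bullet> q j = (if i = j then 1 else (0::real))"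
      and A: "A = (\<Sum>i\<in>UNIV. d i *\<^sub>R outer (q i) (q i))"
      using spectral_theorem[OF sym] by blast
    have "outer (q i) (q i) \<in> free_spectrahedron" for i
      unfolding free_spectrahedron_eq_convex_hull by (rule hull_inc) (auto simp: norm_eq_1 q)
    thus "A \<in> span free_spectrahedron"
      unfolding A by (intro span_sum span_scale span_base)
  qed
qed

text \<open>The trace-one hyperplane misses the origin, so the affine dimension is one less than the linear
  dimension of the span.\<close>

lemma aff_dim_free_spectrahedron:
  "aff_dim (free_spectrahedron :: (real^'n^'n) set) = int ((CARD('n) + 1) choose 2) - 1"
proof -
  let ?S = "free_spectrahedron :: (real^'n^'n) set"
  have "?S \<subseteq> {A. mat 1 \<bullet> A = 1}"
    by (auto simp: free_spectrahedron_def inner_mat_1)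
  hence "affine hull ?S \<subseteq> {A. mat 1 \<bullet> A = 1}"
    by (rule hull_minimal) (rule affine_hyperplane)
  hence "0 \<notin> affine hull ?S"
    by auto
  hence "aff_dim ?S + 1 = aff_dim (insert 0 ?S)"
    by (simp add: aff_dim_insert)
  also have "\<dots> = int (dim (insert 0 ?S))"
    by (rule aff_dim_zero) (simp add: hull_inc)
  also have "\<dots> = int (dim ?S)"
    using dim_span[of "insert 0 ?S"] dim_span[of ?S] by simp
  also have "dim ?S = (CARD('n) + 1) choose 2"
    using dim_span[of ?S] by (simp only: span_free_spectrahedron dim_symmetric_matrices)
  finally show ?thesis
    by simp
qed

section \<open>Two families of exposed faces\<close>

lemma mem_SO_group: "g \<in> SO_group \<longleftrightarrow> orthogonal_matrix g \<and> det g = 1"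
  by (simp add: SO_group_def rotation_matrix_def)

lemma mat_1_SO_group: "mat 1 \<in> SO_group"
  by (simp add: mem_SO_group orthogonal_matrix_id)

lemma SO_group_mult: "g \<in> SO_group \<Longrightarrow> h \<in> SO_group \<Longrightarrow> g ** h \<in> SO_group"
  by (simp add: mem_SO_group orthogonal_matrix_mul det_mul)

lemma SO_group_transpose: "g \<in> SO_group \<Longrightarrow> transpose g \<in> SO_group"
  by (simp add: mem_SO_group)

lemma householder_pair_SO_group:
  "norm u = 1 \<Longrightarrow> norm v = 1 \<Longrightarrow> householder u ** householder v \<in> SO_group"
  by (simp add: mem_SO_group orthogonal_matrix_mul orthogonal_matrix_householder det_mul
      det_householder)

lemma compact_SO_group: "compact (SO_group :: (real^'n^'n) set)"
proof -
  have "SO_group = {Q :: real^'n^'n. orthogonal_matrix Q} \<inter> {Q. det Q = 1}"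
    by (auto simp: mem_SO_group)
  moreover have "closed {Q :: real^'n^'n. det Q = 1}"
    unfolding det_def by (intro closed_Collect_eq continuous_intros)
  ultimately show ?thesis
    using compact_Int_closed[OF compact_orthogonal_matrices] by metis
qed

lemma compact_tautological_orbitope: "compact (tautological_orbitope :: (real^'n^'n) set)"
  unfolding tautological_orbitope_def by (rule compact_convex_hull) (rule compact_SO_group)

lemma convex_tautological_orbitope: "convex (tautological_orbitope :: (real^'n^'n) set)"
  unfolding tautological_orbitope_def by (rule convex_convex_hull)

lemma SO_group_orbitope: "g \<in> SO_group \<Longrightarrow> g \<in> tautological_orbitope"
  unfolding tautological_orbitope_def by (rule hull_inc)

lemma inner_le_on_orbitope:
  fixes N :: "real^'n^'n"
  assumes "\<And>g. g \<in> SO_group \<Longrightarrow> N \<bullet> g \<le> b" "A \<in> tautological_orbitope"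
  shows "N \<bullet> A \<le> b"
proof -
  have "tautological_orbitope \<subseteq> {A. N \<bullet> A \<le> b}"
    unfolding tautological_orbitope_def
    by (rule hull_minimal) (use assms(1) in \<open>auto simp: convex_halfspace_le\<close>)
  thus ?thesis
    using assms(2) by blast
qed

text \<open>A face is the hull of its extreme points; these are extreme in the whole hull of \<open>S\<close> as well and
  so belong to \<open>S\<close>.\<close>

lemma exposed_face_of_convex_hull:
  fixes S :: "'a::euclidean_space set"
  assumes "compact S" and le: "\<And>x. x \<in> S \<Longrightarrow> N \<bullet> x \<le> b"
  shows "(convex hull S) \<inter> {x. N \<bullet> x = b} face_of (convex hull S)"
    and "(convex hull S) \<inter> {x. N \<bullet> x = b} = convex hull {x \<in> S. N \<bullet> x = b}"
proof -
  have "convex hull S \<subseteq> {x. N \<bullet> x \<le> b}"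
    by (rule hull_minimal) (use le in \<open>auto simp: convex_halfspace_le\<close>)
  thus *: "(convex hull S) \<inter> {x. N \<bullet> x = b} face_of (convex hull S)"
    by (intro face_of_Int_supporting_hyperplane_le) auto
  obtain S' where S': "S' \<subseteq> S" "(convex hull S) \<inter> {x. N \<bullet> x = b} = convex hull S'"
    using face_of_convex_hull_subset[OF \<open>compact S\<close> *] .
  have "S' \<subseteq> {x. N \<bullet> x = b}"
    using hull_subset[of S' convex] S'(2) by blast
  hence "convex hull S' \<subseteq> convex hull {x \<in> S. N \<bullet> x = b}"
    using S'(1) by (intro hull_mono) auto
  moreover have "convex hull {x \<in> S. N \<bullet> x = b} \<subseteq> (convex hull S) \<inter> {x. N \<bullet> x = b}"
    by (intro Int_greatest hull_mono hull_minimal convex_hyperplane) auto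
  ultimately show "(convex hull S) \<inter> {x. N \<bullet> x = b} = convex hull {x \<in> S. N \<bullet> x = b}"
    using S'(2) by simp
qed

text \<open>For unit vectors \<open>u\<close>, \<open>v\<close> this is the face of matrices sending \<open>v\<close> to \<open>u\<close>: the functional
  \<open>u \<bullet> A v\<close> is at most \<open>1\<close> on rotations \<open>A\<close>, with equality exactly when \<open>A v = u\<close>.\<close>

definition transport_face :: "real^'n \<Rightarrow> real^'n \<Rightarrow> (real^'n^'n) set" where
  "transport_face u v = tautological_orbitope \<inter> {A. outer u v \<bullet> A = 1}"

text \<open>For an orthogonal \<open>R\<close> of determinant \<open>-1\<close> the number \<open>n - 2\<close> is the largest value of
  \<open>trace (g (transpose R))\<close> over rotations \<open>g\<close>, and it is taken when \<open>g (transpose R)\<close> is a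
  reflection.\<close>

definition reflection_face :: "real^'n^'n \<Rightarrow> (real^'n^'n) set" where
  "reflection_face R = tautological_orbitope \<inter> {A. R \<bullet> A = real CARD('n) - 2}"

lemma transport_le:
  fixes u v :: "real^'n"
  assumes "norm u = 1" "norm v = 1" "g \<in> SO_group"
  shows "outer u v \<bullet> g \<le> 1" and "outer u v \<bullet> g = 1 \<longleftrightarrow> g *v v = u"
proof -
  have "norm (g *v v) = 1"
    using assms by (simp add: mem_SO_group orthogonal_matrix_norm)
  hence eq: "(norm (u - g *v v))\<^sup>2 = 2 - 2 * (outer u v \<bullet> g)"
    using assms by (simp add: power2_norm_eq_inner inner_outer inner_simps norm_eq_1
        inner_commute[of "g *v v" u])
  have "0 \<le> 2 - 2 * (outer u v \<bullet> g)"
    unfolding eq[symmetric] by simp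
  thus "outer u v \<bullet> g \<le> 1"
    by simp
  have "outer u v \<bullet> g = 1 \<longleftrightarrow> (norm (u - g *v v))\<^sup>2 = 0"
    unfolding eq by auto
  thus "outer u v \<bullet> g = 1 \<longleftrightarrow> g *v v = u"
    by auto
qed

lemma reflection_le:
  fixes R :: "real^'n^'n"
  assumes "rotoinversion_matrix R" "g \<in> SO_group"
  shows "R \<bullet> g \<le> real CARD('n) - 2"
    and "R \<bullet> g = real CARD('n) - 2 \<longleftrightarrow> (\<exists>w. norm w = 1 \<and> g = householder w ** R)"
proof -
  have R: "orthogonal_matrix R" "det R = -1"
    using assms(1) by (auto simp: rotoinversion_matrix_def)
  let ?h = "g ** transpose R"
  have h: "orthogonal_matrix ?h" "det ?h = -1"
    using assms R by (auto simp: mem_SO_group orthogonal_matrix_mul det_mul)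
  have tr: "R \<bullet> g = trace ?h"
    using inner_matrix_mult_right[of "mat 1" R g] by (simp add: inner_mat_1)
  show "R \<bullet> g \<le> real CARD('n) - 2"
    unfolding tr by (rule trace_orthogonal_det_minus_1) fact+
  show "R \<bullet> g = real CARD('n) - 2 \<longleftrightarrow> (\<exists>w. norm w = 1 \<and> g = householder w ** R)"
  proof
    assume "R \<bullet> g = real CARD('n) - 2"
    then obtain w where w: "norm w = 1" "?h = householder w"
      using trace_orthogonal_det_minus_1(2)[OF h] tr by auto
    have "g = ?h ** R"
      by (simp add: orthogonal_matrixD[OF R(1)] flip: matrix_mul_assoc)
    with w show "\<exists>w. norm w = 1 \<and> g = householder w ** R"
      by metis
  next
    assume "\<exists>w. norm w = 1 \<and> g = householder w ** R"
    then obtain w where w: "norm w = 1" "g = householder w ** R"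
      by blast
    have "?h = householder w"
      unfolding w(2) by (simp add: orthogonal_matrixD[OF R(1)] flip: matrix_mul_assoc)
    hence "R \<bullet> g = mat 1 \<bullet> householder w"
      by (simp add: tr inner_mat_1)
    also have "\<dots> = real CARD('n) - 2"
      using w by (simp add: inner_commute[of "mat 1"] inner_householder trace_I norm_eq_1)
    finally show "R \<bullet> g = real CARD('n) - 2" .
  qed
qed

lemma transport_face_eq_hull:
  assumes "norm u = 1" "norm v = 1"
  shows "transport_face u v = convex hull {g \<in> SO_group. g *v v = u}"
proof -
  have "transport_face u v = convex hull {g \<in> SO_group. outer u v \<bullet> g = 1}"
    unfolding transport_face_def tautological_orbitope_def
    by (rule exposed_face_of_convex_hull(2)[OF compact_SO_group]) (rule transport_le[OF assms])
  also have "{g \<in> SO_group. outer u v \<bullet> g = 1} = {g \<in> SO_group. g *v v = u}"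
    using transport_le(2)[OF assms] by blast
  finally show ?thesis .
qed

lemma reflection_face_eq_hull:
  assumes "rotoinversion_matrix R"
  shows "reflection_face R = convex hull {householder w ** R |w. norm w = 1}"
proof -
  have "reflection_face R = convex hull {g \<in> SO_group. R \<bullet> g = real CARD('a) - 2}"
    unfolding reflection_face_def tautological_orbitope_def
    by (rule exposed_face_of_convex_hull(2)[OF compact_SO_group]) (rule reflection_le[OF assms])
  also have "{g \<in> SO_group. R \<bullet> g = real CARD('a) - 2} = {householder w ** R |w. norm w = 1}"
  proof -
    have "householder w ** R \<in> SO_group" if "norm w = 1" for w
      using that assms
      by (simp add: mem_SO_group orthogonal_matrix_mul orthogonal_matrix_householder det_mul
          det_householder rotoinversion_matrix_def)
    thus ?thesis
      using reflection_le(2)[OF assms] by blast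
  qed
  finally show ?thesis .
qed

lemma transport_face_SO_group:
  assumes "norm u = 1" "norm v = 1" "g \<in> SO_group" "g *v v = u"
  shows "g \<in> transport_face u v"
  using assms by (simp add: transport_face_eq_hull hull_inc)

lemma reflection_face_householder:
  "rotoinversion_matrix R \<Longrightarrow> norm w = 1 \<Longrightarrow> householder w ** R \<in> reflection_face R"
  by (auto simp: reflection_face_eq_hull intro: hull_inc)

section \<open>Every proper face lies in a member of one of the two families\<close>

text \<open>A functional maximised over the rotations at the identity is a symmetric matrix in which no two
  eigenvalues have a negative sum; both facts come from comparing the identity with the rotations
  \<open>householder u ** householder v\<close>.\<close>

lemma maximal_at_identity:
  fixes C :: "real^'n^'n"
  assumes max: "\<And>g. g \<in> SO_group \<Longrightarrow> C \<bullet> g \<le> trace C"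
  shows "transpose C = C"
    and "\<And>u v. norm u = 1 \<Longrightarrow> norm v = 1 \<Longrightarrow> u \<bullet> v = 0 \<Longrightarrow> 0 \<le> u \<bullet> (C *v u) + v \<bullet> (C *v v)"
proof -
  have key: "2 * (u \<bullet> v) * (u \<bullet> (C *v v)) \<le> u \<bullet> (C *v u) + v \<bullet> (C *v v)"
    if "norm u = 1" "norm v = 1" for u v
  proof -
    have "C \<bullet> (householder u ** householder v) = householder v \<bullet> (householder u ** C)"
      by (simp add: inner_commute[of C] inner_matrix_mult_left)
    also have "\<dots> = trace (householder u ** C) - 2 * (v \<bullet> (householder u *v (C *v v)))"
      by (simp add: inner_householder matrix_vector_mul_assoc)
    also have "trace (householder u ** C) = householder u \<bullet> C"
      using inner_matrix_mult_left[of "householder u" "mat 1" C] by (simp add: inner_mat_1)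
    also have "\<dots> = trace C - 2 * (u \<bullet> (C *v u))"
      by (rule inner_householder)
    finally show ?thesis
      using max[OF householder_pair_SO_group[OF that]]
      by (simp add: householder_mult_vector inner_simps inner_commute[of v u] algebra_simps)
  qed
  show "0 \<le> u \<bullet> (C *v u) + v \<bullet> (C *v v)" if "norm u = 1" "norm v = 1" "u \<bullet> v = 0" for u v
    using key[OF that(1,2)] that(3) by simp
  have comp: "axis i 1 \<bullet> (C *v axis j 1) = C $ i $ j" for i j :: 'n
    by (simp add: inner_axis' matrix_vector_mult_basis column_def)
  have "C $ i $ j = C $ j $ i" if "i \<noteq> j" for i j
  proof -
    have "c * s * (C $ i $ j - C $ j $ i) \<le> s\<^sup>2 * (C $ i $ i + C $ j $ j)"
      if cs: "c\<^sup>2 + s\<^sup>2 = 1" for c s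
    proof -
      define u v :: "real^'n" where "u = axis i 1" and "v = c *\<^sub>R axis i 1 + s *\<^sub>R axis j 1"
      have "norm u = 1" "norm v = 1" "u \<bullet> v = c"
        using cs \<open>i \<noteq> j\<close>
        by (simp_all add: u_def v_def norm_eq_1 inner_simps inner_axis_axis power2_eq_square)
      moreover have "u \<bullet> (C *v v) = c * C $ i $ i + s * C $ i $ j"
        by (simp add: u_def v_def inner_simps comp algebra_simps)
      moreover have "v \<bullet> (C *v v)
          = c\<^sup>2 * C $ i $ i + c * s * (C $ i $ j + C $ j $ i) + s\<^sup>2 * C $ j $ j"
        by (simp add: v_def inner_simps comp algebra_simps power2_eq_square)
      moreover have "u \<bullet> (C *v u) = C $ i $ i"
        by (simp add: u_def comp)
      ultimately have "2 * c * (c * C $ i $ i + s * C $ i $ j)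
          \<le> C $ i $ i + (c\<^sup>2 * C $ i $ i + c * s * (C $ i $ j + C $ j $ i) + s\<^sup>2 * C $ j $ j)"
        using key[of u v] by simp
      moreover have "C $ i $ i = c\<^sup>2 * C $ i $ i + s\<^sup>2 * C $ i $ i"
        using cs by (metis distrib_right mult_1)
      ultimately show ?thesis
        by (simp add: algebra_simps power2_eq_square)
    qed
    from plane_rotation_first_order[OF this] show ?thesis
      by simp
  qed
  thus "transpose C = C"
    by (auto simp: transpose_def vec_eq_iff) metis
qed

text \<open>Normal form of a functional: after translating a maximiser \<open>g\<close> to the identity, the spectral
  theorem writes it as \<open>\<Sum>i. d i * (g (q i) \<bullet> A (q i))\<close>. If all \<open>d i\<close> are nonnegative, it is a
  nonnegative combination of the functionals that cut out transport faces. Otherwise exactly one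
  \<open>d k = - e\<close> is negative while \<open>d i \<ge> e\<close> for the others, and it is the combination with
  coefficients \<open>d i - e\<close> for \<open>i \<noteq> k\<close> together with \<open>e\<close> times the functional of a reflection face.\<close>

lemma exposed_face_subset:
  fixes C :: "real^'n^'n"
  assumes "C \<noteq> 0" and g: "g \<in> SO_group" and max: "\<And>h. h \<in> SO_group \<Longrightarrow> C \<bullet> h \<le> C \<bullet> g"
  shows "(\<exists>u v. norm u = 1 \<and> norm v = 1 \<and>
            tautological_orbitope \<inter> {A. C \<bullet> A = C \<bullet> g} \<subseteq> transport_face u v) \<or>
         (\<exists>R. rotoinversion_matrix R \<and>
            tautological_orbitope \<inter> {A. C \<bullet> A = C \<bullet> g} \<subseteq> reflection_face R)"
proof -
  have og: "orthogonal_matrix g"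
    using g by (simp add: mem_SO_group)
  define D where "D = transpose g ** C"
  have C: "C = g ** D"
    by (simp add: D_def matrix_mul_assoc orthogonal_matrixD[OF og])
  have D_inner: "D \<bullet> h = C \<bullet> (g ** h)" for h
    by (simp add: D_def inner_matrix_mult_left)
  have trD: "trace D = C \<bullet> g"
    using D_inner[of "mat 1"] by (simp add: inner_commute[of D] inner_mat_1)
  have "D \<bullet> h \<le> trace D" if "h \<in> SO_group" for h
    unfolding D_inner trD by (rule max) (rule SO_group_mult[OF g that])
  note D_max = maximal_at_identity[OF this]
  obtain q :: "'n \<Rightarrow> real^'n" and d where q: "\<And>i j. q i \<bullet> q j = (if i = j then 1 else 0)"
    and D: "D = (\<Sum>i\<in>UNIV. d i *\<^sub>R outer (q i) (q i))"
    using spectral_theorem[OF D_max(1)] by blast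
  have nq: "norm (q i) = 1" for i
    by (simp add: norm_eq_1 q)
  define p where "p i = g *v q i" for i
  have np: "norm (p i) = 1" for i
    by (simp add: p_def orthogonal_matrix_norm[OF og] nq)
  have C_inner: "C \<bullet> A = (\<Sum>i\<in>UNIV. d i * (outer (p i) (q i) \<bullet> A))" for A
    unfolding C D
    by (simp add: linear_sum[OF linear_matrix_mult_left] linear_scale[OF linear_matrix_mult_left]
        matrix_mult_outer inner_sum_left p_def)
  have D_q: "q i \<bullet> (D *v q i) = d i" for i
    unfolding D by (rule inner_diagonalized_frame) (rule q)
  have d_sum: "0 \<le> d i + d j" if "i \<noteq> j" for i j
    using D_max(2)[of "q i" "q j"] that by (simp add: nq q D_q)
  have "outer (p i) (q i) \<bullet> g = 1" for i
    using transport_le(2)[OF np nq g] by (simp add: p_def)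
  hence C_g: "C \<bullet> g = (\<Sum>i\<in>UNIV. d i)"
    by (simp add: C_inner)
  have x_le: "outer (p i) (q i) \<bullet> A \<le> 1" if "A \<in> tautological_orbitope" for A i
    by (rule inner_le_on_orbitope[OF _ that]) (rule transport_le[OF np nq])
  have defect: "(\<Sum>i\<in>UNIV. d i * (1 - outer (p i) (q i) \<bullet> A)) = 0" if "C \<bullet> A = C \<bullet> g" for A
    using that by (simp add: C_g C_inner[of A] right_diff_distrib sum_subtractf)
  show ?thesis
  proof (cases "\<forall>i. 0 \<le> d i")
    case True
    have "\<exists>k. d k \<noteq> 0"
    proof (rule ccontr)
      assume "\<not> (\<exists>k. d k \<noteq> 0)"
      hence "D = 0"
        by (simp add: D)
      with \<open>C \<noteq> 0\<close> show False
        by (simp add: C linear_0[OF linear_matrix_mult_left])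
    qed
    then obtain k where k: "d k > 0"
      using True by (metis less_eq_real_def)
    have "A \<in> transport_face (p k) (q k)"
      if A: "A \<in> tautological_orbitope" "C \<bullet> A = C \<bullet> g" for A
    proof -
      have "\<forall>i\<in>UNIV. d i * (1 - outer (p i) (q i) \<bullet> A) = 0"
        using defect[OF A(2)] True x_le[OF A(1)]
        by (subst (asm) sum_nonneg_eq_0_iff) (auto intro: mult_nonneg_nonneg)
      hence "outer (p k) (q k) \<bullet> A = 1"
        using k by simp (metis less_irrefl)
      with A show ?thesis
        by (simp add: transport_face_def)
    qed
    with np nq show ?thesis
      by blast
  next
    case False
    then obtain k where k: "d k < 0"
      by (auto simp: not_le)
    define e where "e = - d k"
    define R where "R = g ** householder (q k)"
    have R: "rotoinversion_matrix R"
      using g nq by (simp add: R_def rotoinversion_matrix_def mem_SO_group orthogonal_matrix_mul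
          orthogonal_matrix_householder det_mul det_householder)
    have R_inner: "R \<bullet> A = (\<Sum>i\<in>UNIV. outer (p i) (q i) \<bullet> A) - 2 * (outer (p k) (q k) \<bullet> A)" for A
    proof -
      have "householder (q k) = (\<Sum>i\<in>UNIV. outer (q i) (q i)) - 2 *\<^sub>R outer (q k) (q k)"
        by (simp add: householder_def orthonormal_frame_sum_outer q)
      hence "R = (\<Sum>i\<in>UNIV. outer (p i) (q i)) - 2 *\<^sub>R outer (p k) (q k)"
        by (simp add: R_def linear_sum[OF linear_matrix_mult_left]
            linear_scale[OF linear_matrix_mult_left] linear_diff[OF linear_matrix_mult_left]
            matrix_mult_outer p_def)
      thus ?thesis
        by (simp add: inner_diff_left inner_sum_left)
    qed
    have "A \<in> reflection_face R"
      if A: "A \<in> tautological_orbitope" "C \<bullet> A = C \<bullet> g" for A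
    proof -
      define x where "x i = 1 - outer (p i) (q i) \<bullet> A" for i
      have x: "0 \<le> x i" for i
        using x_le[OF A(1)] by (simp add: x_def)
      have split: "(\<Sum>i\<in>UNIV. f i) = f k + (\<Sum>i\<in>UNIV - {k}. f i)" for f :: "'n \<Rightarrow> real"
        by (simp add: sum.remove)
      have RA: "real CARD('n) - 2 - R \<bullet> A = (\<Sum>i\<in>UNIV. x i) - 2 * x k"
        by (simp add: R_inner x_def sum_subtractf)
      have "0 = (\<Sum>i\<in>UNIV. d i * x i)"
        using defect[OF A(2)] by (simp add: x_def)
      also have "\<dots> = (\<Sum>i\<in>UNIV - {k}. (d i - e) * x i) + e * ((\<Sum>i\<in>UNIV. x i) - 2 * x k)"
        by (simp add: split e_def left_diff_distrib sum_subtractf sum.distrib sum_distrib_left algebra_simps sum_negf)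
      finally have "(\<Sum>i\<in>UNIV - {k}. (d i - e) * x i) + e * (real CARD('n) - 2 - R \<bullet> A) = 0"
        by (simp add: RA)
      moreover have "0 \<le> (\<Sum>i\<in>UNIV - {k}. (d i - e) * x i)"
      proof (rule sum_nonneg)
        fix i assume "i \<in> UNIV - {k}"
        hence "0 \<le> d i - e"
          using d_sum[of i k] by (simp add: e_def)
        thus "0 \<le> (d i - e) * x i"
          using x by simp
      qed
      moreover have "R \<bullet> A \<le> real CARD('n) - 2"
        by (rule inner_le_on_orbitope[OF _ A(1)]) (rule reflection_le[OF R])
      moreover have "e > 0"
        using k by (simp add: e_def)
      ultimately have "R \<bullet> A = real CARD('n) - 2"
        by (smt (verit) mult_pos_pos)
      with A show ?thesis
        by (simp add: reflection_face_def)
    qed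
    with R show ?thesis
      by blast
  qed
qed

text \<open>A nonempty proper face has a relative interior point on the relative boundary of the orbitope. The
  face cut out there by a supporting hyperplane contains the given one, and the preceding lemma
  applies to it.\<close>

lemma proper_face_subset:
  fixes F :: "(real^'n^'n) set"
  assumes "proper_face F tautological_orbitope"
  shows "(\<exists>u v. norm u = 1 \<and> norm v = 1 \<and> F \<subseteq> transport_face u v) \<or>
         (\<exists>R. rotoinversion_matrix R \<and> F \<subseteq> reflection_face R)"
proof (cases "F = {}")
  case True
  \<comment> \<open>The empty face lies in every transport face; any coordinate vector will do.\<close>
  have "norm (axis undefined 1 :: real^'n) = 1"
    by simp
  with True show ?thesis
    by blast
next
  case False
  let ?K = "tautological_orbitope :: (real^'n^'n) set"
  have face: "F face_of ?K" and ne: "F \<noteq> ?K"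
    using assms by (auto simp: proper_face_def)
  have FK: "F \<subseteq> ?K"
    by (rule face_of_imp_subset[OF face])
  obtain A where A: "A \<in> rel_interior F"
    using False rel_interior_eq_empty[OF face_of_imp_convex[OF face]] by blast
  have AF: "A \<in> F"
    using A rel_interior_subset by blast
  have AK: "A \<in> ?K"
    using AF FK by blast
  have Ar: "A \<notin> rel_interior ?K"
    using face_of_disjoint_rel_interior[OF face ne] AF by blast
  obtain a where "a \<noteq> 0" and min: "\<And>B. B \<in> ?K \<Longrightarrow> a \<bullet> A \<le> a \<bullet> B"
    using supporting_hyperplane_rel_boundary[OF convex_tautological_orbitope AK Ar] by metis
  define C where "C = - a"
  have "C \<noteq> 0"
    using \<open>a \<noteq> 0\<close> by (simp add: C_def)
  have "continuous_on SO_group ((\<bullet>) C)"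
    by (intro continuous_intros)
  then obtain g where g: "g \<in> SO_group" and g_max: "\<And>h. h \<in> SO_group \<Longrightarrow> C \<bullet> h \<le> C \<bullet> g"
    using continuous_attains_sup[OF compact_SO_group] mat_1_SO_group by blast
  have "C \<bullet> A \<le> C \<bullet> g"
    by (rule inner_le_on_orbitope[OF g_max]) (use AF FK in auto)
  moreover have "C \<bullet> g \<le> C \<bullet> A"
    using min[OF SO_group_orbitope[OF g]] by (simp add: C_def)
  ultimately have CA: "C \<bullet> A = C \<bullet> g"
    by simp
  have "?K \<inter> {B. a \<bullet> B = a \<bullet> A} face_of ?K"
    by (rule face_of_Int_supporting_hyperplane_ge[OF convex_tautological_orbitope min])
  hence "F \<subseteq> ?K \<inter> {B. a \<bullet> B = a \<bullet> A}"
    by (rule subset_of_face_of) (use A AF FK in auto)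
  hence "F \<subseteq> ?K \<inter> {B. C \<bullet> B = C \<bullet> g}"
    unfolding CA[symmetric] by (auto simp: C_def)
  with exposed_face_subset[OF \<open>C \<noteq> 0\<close> g g_max] show ?thesis
    by (meson order_trans)
qed

section \<open>Inclusions between the faces of the two families\<close>

lemma orthonormal_frame_through:
  fixes v :: "real^'n"
  assumes "norm v = 1"
  obtains q :: "'n \<Rightarrow> real^'n" and k
  where "\<And>i j. q i \<bullet> q j = (if i = j then 1 else 0)" "q k = v"
proof -
  obtain k :: 'n and Q where Q: "orthogonal_matrix Q" "Q *v axis k 1 = v"
    using orthogonal_matrix_exists_basis[OF assms] by metis
  show thesis
    by (rule that[of "\<lambda>i. Q *v axis i 1" k])
      (use Q in \<open>auto simp: orthogonal_matrix_inner inner_axis_axis\<close>)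
qed

lemma exists_rotation_between_unit_vectors:
  fixes u v :: "real^'n"
  assumes "CARD('n) \<ge> 2" "norm u = 1" "norm v = 1"
  obtains g where "g \<in> SO_group" "g *v v = u"
proof -
  obtain f where f: "orthogonal_transformation f" "det (matrix f) = 1" "f v = u"
    using rotation_exists_1[OF assms(1,3,2)] .
  show thesis
    by (rule that[of "matrix f"])
      (use f in \<open>auto simp: mem_SO_group orthogonal_transformation_matrix matrix_works
        linear_matrix_vector_mul_eq\<close>)
qed

text \<open>Both reflections fix \<open>v\<close>, so applying them before \<open>g\<close> does not leave the face.\<close>

lemma transport_face_householder_pair:
  fixes u v :: "real^'n"
  assumes "norm u = 1" "norm v = 1" "g \<in> SO_group" "g *v v = u"
    and "norm a = 1" "norm b = 1" "a \<bullet> v = 0" "b \<bullet> v = 0"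
  shows "g ** (householder a ** householder b) \<in> transport_face u v"
  using assms
  by (intro transport_face_SO_group SO_group_mult householder_pair_SO_group)
    (auto simp: householder_mult_vector simp flip: matrix_vector_mul_assoc)

text \<open>If \<open>v'\<close> is sent to one point by all rotations taking \<open>v\<close> to \<open>u\<close>, it is fixed by products of two
  reflections along orthonormal vectors orthogonal to \<open>v\<close>, hence orthogonal to all of these vectors,
  hence \<open>v' = v\<close> or \<open>v' = - v\<close>. The face does not change when both vectors change sign.\<close>

lemma transport_face_subset_imp_eq:
  fixes u v u' v' :: "real^'n"
  assumes n: "CARD('n) \<ge> 3"
    and unit: "norm u = 1" "norm v = 1" "norm u' = 1" "norm v' = 1"
    and sub: "transport_face u v \<subseteq> transport_face u' v'"
  shows "transport_face u v = transport_face u' v'"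
proof -
  obtain g where g: "g \<in> SO_group" "g *v v = u"
    using exists_rotation_between_unit_vectors[of u v] n unit by auto
  obtain q :: "'n \<Rightarrow> real^'n" and k where q: "\<And>i j. q i \<bullet> q j = (if i = j then 1 else 0)"
    and qk: "q k = v"
    using orthonormal_frame_through[OF unit(2)] by blast
  have nq: "norm (q i) = 1" for i
    by (simp add: norm_eq_1 q)
  have move: "h *v v' = u'" if "h \<in> SO_group" "h *v v = u" for h
    using transport_face_SO_group[OF unit(1,2) that] sub transport_le(2)[OF unit(3,4) that(1)]
    by (auto simp: transport_face_def)
  have fix2: "householder (q i) *v (householder (q j) *v v') = v'" if "i \<noteq> k" "j \<noteq> k" for i j
  proof -
    let ?h = "g ** (householder (q i) ** householder (q j))"
    have "?h \<in> SO_group"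
      by (intro SO_group_mult g householder_pair_SO_group nq)
    moreover have "?h *v v = u"
      using that g(2) by (simp add: householder_mult_vector q flip: qk matrix_vector_mul_assoc)
    ultimately have "?h *v v' = g *v v'"
      using move g by simp
    hence "transpose g *v (g *v (householder (q i) *v (householder (q j) *v v')))
        = transpose g *v (g *v v')"
      by (simp flip: matrix_vector_mul_assoc)
    thus ?thesis
      using g(1) by (simp only: mem_SO_group orthogonal_matrix_cancel)
  qed
  have perp: "q i \<bullet> v' = 0" if i: "i \<noteq> k" for i
  proof -
    \<comment> \<open>A third index exists because \<open>n \<ge> 3\<close>.\<close>
    have "card {i, k} < CARD('n)"
      using n i by simp
    then obtain j where j: "j \<noteq> i" "j \<noteq> k"
      by (metis (full_types) UNIV_eq_I insertCI less_irrefl)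
    have "q i \<bullet> v' = q i \<bullet> (householder (q i) *v (householder (q j) *v v'))"
      using fix2[OF i j(2)] by simp
    also have "\<dots> = - (q i \<bullet> v')"
      using j by (simp add: householder_mult_vector inner_simps q)
    finally show ?thesis
      by simp
  qed
  define s where "s = v \<bullet> v'"
  have "v' = (\<Sum>i\<in>UNIV. (q i \<bullet> v') *\<^sub>R q i)"
    by (rule orthonormal_frame_expansion) (rule q)
  also have "\<dots> = (\<Sum>i\<in>UNIV. if i = k then s *\<^sub>R v else 0)"
    by (rule sum.cong) (auto simp: perp qk s_def)
  finally have v': "v' = s *\<^sub>R v"
    by simp
  have "u' = g *v v'"
    using move g by simp
  hence u': "u' = s *\<^sub>R u"
    by (simp add: v' matrix_vector_mult_scaleR g)
  have "\<bar>s\<bar> = 1"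
    using unit(2,4) by (simp add: v')
  hence "s * s = 1"
    by (metis abs_mult_self_eq mult_1)
  hence "outer u' v' = outer u v"
    by (simp add: u' v' outer_def vec_eq_iff)
  thus ?thesis
    by (simp add: transport_face_def)
qed

text \<open>A rotation \<open>g\<close> with \<open>g v = u\<close> in a reflection face of \<open>R\<close> gives \<open>transpose g R\<close> as the reflection
  along some \<open>w\<close>. Moving by products of two reflections orthogonal to \<open>v\<close> forces
  \<open>(a \<bullet> w)\<^sup>2 + (b \<bullet> w)\<^sup>2 = 1\<close> for all orthonormal \<open>a\<close>, \<open>b\<close> orthogonal to \<open>v\<close>. With three such vectors
  available this contradicts \<open>norm w = 1\<close>; for \<open>n = 3\<close> the inclusion does occur.\<close>

lemma transport_face_not_subset_reflection_face:
  fixes u v :: "real^'n"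
  assumes n: "CARD('n) \<ge> 4"
    and unit: "norm u = 1" "norm v = 1" and R: "rotoinversion_matrix R"
  shows "\<not> transport_face u v \<subseteq> reflection_face R"
proof
  assume sub: "transport_face u v \<subseteq> reflection_face R"
  obtain g where g: "g \<in> SO_group" "g *v v = u"
    using exists_rotation_between_unit_vectors[of u v] n unit by auto
  obtain q :: "'n \<Rightarrow> real^'n" and k where q: "\<And>i j. q i \<bullet> q j = (if i = j then 1 else 0)"
    and qk: "q k = v"
    using orthonormal_frame_through[OF unit(2)] by blast
  have nq: "norm (q i) = 1" for i
    by (simp add: norm_eq_1 q)
  define S where "S = transpose g ** R"
  have S: "rotoinversion_matrix S"
    using g R by (simp add: S_def rotoinversion_matrix_def mem_SO_group orthogonal_matrix_mul det_mul)
  have mem: "S \<bullet> h = real CARD('n) - 2" if "g ** h \<in> transport_face u v" for h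
  proof -
    have "R \<bullet> (g ** h) = real CARD('n) - 2"
      using that sub by (auto simp: reflection_face_def)
    thus ?thesis
      using inner_matrix_mult_left[of g h R] by (simp add: S_def inner_commute)
  qed
  have "S \<bullet> mat 1 = real CARD('n) - 2"
    by (rule mem) (use transport_face_SO_group[OF unit g] in simp)
  then obtain w where w: "norm w = 1" "S = householder w"
    using trace_orthogonal_det_minus_1(2)[of S] S
    by (auto simp: rotoinversion_matrix_def inner_commute[of S] inner_mat_1)
  have *: "(q i \<bullet> w)\<^sup>2 + (q j \<bullet> w)\<^sup>2 = 1" if ij: "i \<noteq> k" "j \<noteq> k" "i \<noteq> j" for i j
  proof -
    let ?H = "householder (q i) ** householder (q j)"
    have "g ** ?H \<in> transport_face u v"
      by (rule transport_face_householder_pair[OF unit g]) (use ij in \<open>auto simp: nq q simp flip: qk\<close>)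
    hence "real CARD('n) - 2 = householder w \<bullet> ?H"
      using mem w by simp
    also have "\<dots> = trace ?H - 2 * (w \<bullet> (householder (q i) *v (householder (q j) *v w)))"
      by (simp add: inner_householder matrix_vector_mul_assoc)
    also have "trace ?H = householder (q i) \<bullet> householder (q j)"
      using inner_matrix_mult_left[of "householder (q i)" "mat 1" "householder (q j)"]
      by (simp add: inner_mat_1)
    also have "\<dots> = real CARD('n) - 4"
    proof -
      have "trace (householder (q j)) = real CARD('n) - 2"
        using inner_householder[of "q j" "mat 1"]
        by (simp add: inner_commute[of _ "mat 1"] inner_mat_1 trace_I q)
      thus ?thesis
        using ij by (simp add: inner_householder householder_mult_vector inner_simps q)
    qed
    also have "w \<bullet> (householder (q i) *v (householder (q j) *v w))
        = 1 - 2 * (q i \<bullet> w)\<^sup>2 - 2 * (q j \<bullet> w)\<^sup>2"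
      using ij w(1)
      by (simp add: householder_mult_vector inner_simps q norm_eq_1 inner_commute[of w "q i"] inner_commute[of w "q j"]
          power2_eq_square algebra_simps)
    finally show ?thesis
      by simp
  qed
  obtain a b c where abc: "a \<noteq> k" "b \<noteq> k" "c \<noteq> k" "a \<noteq> b" "b \<noteq> c" "a \<noteq> c"
  proof -
    have "3 \<le> card (UNIV - {k})"
      using n by (simp add: card_Diff_singleton)
    then obtain T where "T \<subseteq> UNIV - {k}" "card T = 3"
      by (meson obtain_subset_with_card_n)
    thus thesis
      using that by (auto simp: card_3_iff)
  qed
  have "(\<Sum>i\<in>{a, b, c}. (q i \<bullet> w)\<^sup>2) \<le> (\<Sum>i\<in>UNIV. (q i \<bullet> w)\<^sup>2)"
    by (rule sum_mono2) auto
  also have "\<dots> = w \<bullet> w"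
    by (subst (3) orthonormal_frame_expansion[of q w, OF q])
      (simp add: inner_sum_right power2_eq_square inner_commute)
  finally show False
    using *[of a b] *[of b c] *[of a c] abc w(1) by (simp add: norm_eq_1)
qed

text \<open>The reflections of the vector \<open>x = R v\<close> do not all agree: the one along \<open>x\<close> gives \<open>- x\<close>, the ones
  along vectors orthogonal to \<open>x\<close> give \<open>x\<close>.\<close>

lemma reflection_face_not_subset_transport_face:
  fixes u v :: "real^'n"
  assumes n: "CARD('n) \<ge> 2"
    and unit: "norm u = 1" "norm v = 1" and R: "rotoinversion_matrix R"
  shows "\<not> reflection_face R \<subseteq> transport_face u v"
proof
  assume sub: "reflection_face R \<subseteq> transport_face u v"
  let ?x = "R *v v"
  have R': "orthogonal_matrix R" "det R = -1"
    using R by (auto simp: rotoinversion_matrix_def)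
  have nx: "norm ?x = 1"
    by (simp add: orthogonal_matrix_norm[OF R'(1)] unit)
  have move: "householder w *v ?x = u" if w: "norm w = 1" for w
  proof -
    have "householder w ** R \<in> SO_group"
      using w R' by (simp add: mem_SO_group orthogonal_matrix_mul orthogonal_matrix_householder
          det_mul det_householder)
    moreover have "outer u v \<bullet> (householder w ** R) = 1"
      using reflection_face_householder[OF R w] sub by (auto simp: transport_face_def)
    ultimately have "(householder w ** R) *v v = u"
      using transport_le(2)[OF unit] by blast
    thus ?thesis
      by (simp add: matrix_vector_mul_assoc)
  qed
  obtain q :: "'n \<Rightarrow> real^'n" and k where q: "\<And>i j. q i \<bullet> q j = (if i = j then 1 else 0)"
    and qk: "q k = ?x"
    using orthonormal_frame_through[OF nx] by blast
  have "card {k} < CARD('n)"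
    using n by simp
  then obtain j where j: "j \<noteq> k"
    by (metis (full_types) UNIV_eq_I insertCI less_irrefl)
  have "u = - ?x"
    using move[OF nx] nx by (auto simp: householder_mult_vector norm_eq_1 scaleR_2)
  moreover have "u = ?x"
    using move[of "q j"] j by (simp add: householder_mult_vector norm_eq_1 q flip: qk)
  ultimately have "- ?x \<bullet> ?x = ?x \<bullet> ?x"
    by metis
  thus False
    using nx by (simp add: norm_eq_1)
qed

text \<open>If all reflections times \<open>R\<close> lie in the face of \<open>R'\<close>, the diagonal entries of
  \<open>S = R' (transpose R)\<close> all equal \<open>(trace S - (n - 2)) / 2\<close>; summing them gives \<open>trace S = n\<close>, which
  for an orthogonal matrix means \<open>S = 1\<close>.\<close>

lemma reflection_face_subset_imp_eq:
  fixes R R' :: "real^'n^'n"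
  assumes n: "CARD('n) \<ge> 3"
    and R: "rotoinversion_matrix R" "rotoinversion_matrix R'"
    and sub: "reflection_face R \<subseteq> reflection_face R'"
  shows "R = R'"
proof -
  have oR: "orthogonal_matrix R" "orthogonal_matrix R'"
    using R by (auto simp: rotoinversion_matrix_def)
  define S where "S = R' ** transpose R"
  have oS: "orthogonal_matrix S"
    by (simp add: S_def orthogonal_matrix_mul oR)
  have "2 * S $ i $ i = trace S - (real CARD('n) - 2)" for i
  proof -
    have "R' \<bullet> (householder (axis i 1) ** R) = real CARD('n) - 2"
      using reflection_face_householder[OF R(1), of "axis i 1"] sub
      by (auto simp: reflection_face_def)
    hence "householder (axis i 1) \<bullet> S = real CARD('n) - 2"
      by (simp add: S_def inner_commute[of R'] inner_matrix_mult_right)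
    thus ?thesis
      by (simp add: inner_householder inner_axis' matrix_vector_mult_basis column_def)
  qed
  hence "(\<Sum>i\<in>(UNIV :: 'n set). 2 * S $ i $ i) = (\<Sum>i\<in>(UNIV :: 'n set). trace S - (real CARD('n) - 2))"
    by simp
  hence "2 * trace S = real CARD('n) * (trace S - (real CARD('n) - 2))"
    by (simp add: trace_def sum_distrib_left)
  hence "(real CARD('n) - 2) * (trace S - real CARD('n)) = 0"
    by (simp add: algebra_simps)
  hence tr: "trace S = real CARD('n)"
    using n by simp
  have "(S - mat 1) \<bullet> (S - mat 1) = S \<bullet> S + mat 1 \<bullet> (mat 1 :: real^'n^'n) - 2 * trace S"
    by (simp add: inner_simps inner_commute[of S "mat 1"] inner_mat_1)
  also have "\<dots> = 0"
    by (simp add: tr inner_orthogonal_matrix[OF oS] inner_mat_1 trace_I)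
  finally have "S = mat 1"
    by simp
  have "R' = S ** R"
    by (simp add: S_def orthogonal_matrixD[OF oR(1)] flip: matrix_mul_assoc)
  thus ?thesis
    by (simp add: \<open>S = mat 1\<close>)
qed

section \<open>The maximal faces and their orbits\<close>

lemma rotoinversion_exists: "\<exists>R :: real^'n^'n. rotoinversion_matrix R"
proof -
  have "rotoinversion_matrix (householder (axis undefined 1 :: real^'n))"
    by (simp add: rotoinversion_matrix_def orthogonal_matrix_householder det_householder)
  thus ?thesis
    by blast
qed

text \<open>A face of either family is proper: the orbitope contains the faces of the other family, and
  these are not subsets of it.\<close>

lemma proper_face_transport_face:
  fixes u v :: "real^'n"
  assumes "CARD('n) \<ge> 2" "norm u = 1" "norm v = 1"
  shows "proper_face (transport_face u v) tautological_orbitope"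
proof -
  obtain R :: "real^'n^'n" where R: "rotoinversion_matrix R"
    using rotoinversion_exists by blast
  have "transport_face u v face_of tautological_orbitope"
    unfolding transport_face_def tautological_orbitope_def
    by (rule exposed_face_of_convex_hull(1)[OF compact_SO_group]) (rule transport_le[OF assms(2,3)])
  moreover have "closed (transport_face u v)"
    unfolding transport_face_def
    by (intro closed_Int compact_imp_closed compact_tautological_orbitope closed_hyperplane)
  moreover have "reflection_face R \<subseteq> tautological_orbitope"
    by (auto simp: reflection_face_def)
  ultimately show ?thesis
    using reflection_face_not_subset_transport_face[OF assms R] by (auto simp: proper_face_def)
qed

lemma proper_face_reflection_face:
  fixes R :: "real^'n^'n"
  assumes "CARD('n) \<ge> 4" "rotoinversion_matrix R"
  shows "proper_face (reflection_face R) tautological_orbitope"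
proof -
  let ?e = "axis undefined 1 :: real^'n"
  have "reflection_face R face_of tautological_orbitope"
    unfolding reflection_face_def tautological_orbitope_def
    by (rule exposed_face_of_convex_hull(1)[OF compact_SO_group]) (rule reflection_le[OF assms(2)])
  moreover have "closed (reflection_face R)"
    unfolding reflection_face_def
    by (intro closed_Int compact_imp_closed compact_tautological_orbitope closed_hyperplane)
  moreover have "transport_face ?e ?e \<subseteq> tautological_orbitope"
    by (auto simp: transport_face_def)
  moreover have "\<not> transport_face ?e ?e \<subseteq> reflection_face R"
    by (rule transport_face_not_subset_reflection_face) (use assms in auto)
  ultimately show ?thesis
    by (auto simp: proper_face_def)
qed

text \<open>A maximal proper face lies in a member of one of the families, which is itself proper, and so
  equals it. Conversely a proper face above a member \<open>F\<close> of the families lies in another member \<open>F'\<close>,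
  and the inclusion results give \<open>F = F'\<close>.\<close>

theorem maximal_facet_orbitope_iff:
  fixes F :: "(real^'n^'n) set"
  assumes n: "CARD('n) \<ge> 4"
  shows "maximal_facet F tautological_orbitope \<longleftrightarrow>
    (\<exists>u v. norm u = 1 \<and> norm v = 1 \<and> F = transport_face u v) \<or>
    (\<exists>R. rotoinversion_matrix R \<and> F = reflection_face R)"
proof
  assume max: "maximal_facet F tautological_orbitope"
  hence maxD: "G = F" if "proper_face G tautological_orbitope" "F \<subseteq> G" for G
    using that by (auto simp: maximal_facet_def)
  have "proper_face F tautological_orbitope"
    using max by (simp add: maximal_facet_def)
  from proper_face_subset[OF this]
  show "(\<exists>u v. norm u = 1 \<and> norm v = 1 \<and> F = transport_face u v) \<or>
    (\<exists>R. rotoinversion_matrix R \<and> F = reflection_face R)"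
  proof (elim disjE exE conjE)
    fix u v :: "real^'n"
    assume *: "norm u = 1" "norm v = 1" "F \<subseteq> transport_face u v"
    have "transport_face u v = F"
      by (rule maxD) (use * n in \<open>auto intro!: proper_face_transport_face\<close>)
    with * show ?thesis
      by blast
  next
    fix R :: "real^'n^'n"
    assume *: "rotoinversion_matrix R" "F \<subseteq> reflection_face R"
    have "reflection_face R = F"
      by (rule maxD) (use * n in \<open>auto intro!: proper_face_reflection_face\<close>)
    with * show ?thesis
      by blast
  qed
next
  assume "(\<exists>u v. norm u = 1 \<and> norm v = 1 \<and> F = transport_face u v) \<or>
    (\<exists>R. rotoinversion_matrix R \<and> F = reflection_face R)"
  thus "maximal_facet F tautological_orbitope"
  proof (elim disjE exE conjE)
    fix u v :: "real^'n"
    assume uv: "norm u = 1" "norm v = 1" and F: "F = transport_face u v"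
    show ?thesis
      unfolding maximal_facet_def
    proof (intro conjI allI impI; (elim conjE)?)
      show "proper_face F tautological_orbitope"
        unfolding F by (rule proper_face_transport_face) (use n uv in auto)
      fix G assume G: "proper_face G tautological_orbitope" and FG: "F \<subseteq> G"
      from proper_face_subset[OF G] show "G = F"
      proof (elim disjE exE conjE)
        fix u' v' assume *: "norm u' = 1" "norm v' = 1" "G \<subseteq> transport_face u' v'"
        have "transport_face u v = transport_face u' v'"
          by (rule transport_face_subset_imp_eq) (use n uv * F FG in auto)
        with * F FG show "G = F"
          by blast
      next
        fix R assume *: "rotoinversion_matrix R" "G \<subseteq> reflection_face R"
        hence False
          using transport_face_not_subset_reflection_face[OF n uv *(1)] F FG by blast
        thus "G = F" ..
      qed
    qed
  next
    fix R :: "real^'n^'n"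
    assume R: "rotoinversion_matrix R" and F: "F = reflection_face R"
    show ?thesis
      unfolding maximal_facet_def
    proof (intro conjI allI impI; (elim conjE)?)
      show "proper_face F tautological_orbitope"
        unfolding F by (rule proper_face_reflection_face[OF n R])
      fix G assume G: "proper_face G tautological_orbitope" and FG: "F \<subseteq> G"
      from proper_face_subset[OF G] show "G = F"
      proof (elim disjE exE conjE)
        fix u v :: "real^'n" assume *: "norm u = 1" "norm v = 1" "G \<subseteq> transport_face u v"
        hence False
          using reflection_face_not_subset_transport_face[OF _ *(1,2) R] n F FG by auto
        thus "G = F" ..
      next
        fix R' assume *: "rotoinversion_matrix R'" "G \<subseteq> reflection_face R'"
        have "R = R'"
          by (rule reflection_face_subset_imp_eq) (use n R * F FG in auto)
        with * F FG show "G = F"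
          by blast
      qed
    qed
  qed
qed

lemma linear_SO_SO_act: "linear (SO_SO_act g h)"
  unfolding SO_SO_act_def
  using linear_compose[OF linear_matrix_mult_left linear_matrix_mult_right] by (simp add: o_def)

lemma SO_SO_act_inverse:
  assumes "g \<in> SO_group" "h \<in> SO_group"
  shows "SO_SO_act (transpose g) (transpose h) (SO_SO_act g h A) = A"
    and "SO_SO_act g h (SO_SO_act (transpose g) (transpose h) A) = A"
proof -
  have *: "g ** transpose g = mat 1" "transpose g ** g = mat 1"
    "h ** transpose h = mat 1" "transpose h ** h = mat 1"
    using assms by (auto simp: mem_SO_group orthogonal_matrixD)
  have "SO_SO_act (transpose g) (transpose h) (SO_SO_act g h A)
      = (transpose g ** g) ** A ** (transpose h ** h)"
    by (simp add: SO_SO_act_def matrix_mul_assoc)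
  thus "SO_SO_act (transpose g) (transpose h) (SO_SO_act g h A) = A"
    by (simp add: *)
  have "SO_SO_act g h (SO_SO_act (transpose g) (transpose h) A)
      = (g ** transpose g) ** A ** (h ** transpose h)"
    by (simp add: SO_SO_act_def matrix_mul_assoc)
  thus "SO_SO_act g h (SO_SO_act (transpose g) (transpose h) A) = A"
    by (simp add: *)
qed

lemma SO_SO_act_orbitope:
  assumes "g \<in> SO_group" "h \<in> SO_group" "A \<in> tautological_orbitope"
  shows "SO_SO_act g h A \<in> tautological_orbitope"
proof -
  have "SO_SO_act g h ` (convex hull SO_group) = convex hull (SO_SO_act g h ` SO_group)"
    by (rule convex_hull_linear_image) (rule linear_SO_SO_act)
  also have "\<dots> \<subseteq> convex hull SO_group"
    by (rule hull_mono)
      (use assms in \<open>auto simp: SO_SO_act_def intro!: SO_group_mult SO_group_transpose\<close>)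
  finally show ?thesis
    using assms(3) by (auto simp: tautological_orbitope_def)
qed

lemma inner_SO_SO_act:
  assumes "g \<in> SO_group" "h \<in> SO_group"
  shows "SO_SO_act g h N \<bullet> SO_SO_act g h A = N \<bullet> A"
proof -
  have *: "transpose g ** g = mat 1" "transpose h ** h = mat 1"
    using assms by (auto simp: mem_SO_group orthogonal_matrixD)
  have "SO_SO_act g h N \<bullet> SO_SO_act g h A = (g ** N) \<bullet> (g ** A ** (transpose h ** h))"
    by (simp add: SO_SO_act_def inner_matrix_mult_right matrix_mul_assoc)
  also have "\<dots> = N \<bullet> ((transpose g ** g) ** A)"
    by (simp add: * inner_matrix_mult_left matrix_mul_assoc)
  finally show ?thesis
    by (simp add: *)
qed

lemma SO_SO_act_exposed_face:
  assumes "g \<in> SO_group" "h \<in> SO_group"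
  shows "SO_SO_act g h ` (tautological_orbitope \<inter> {A. N \<bullet> A = b})
    = tautological_orbitope \<inter> {A. SO_SO_act g h N \<bullet> A = b}"
proof (intro equalityI subsetI)
  fix B assume "B \<in> SO_SO_act g h ` (tautological_orbitope \<inter> {A. N \<bullet> A = b})"
  thus "B \<in> tautological_orbitope \<inter> {A. SO_SO_act g h N \<bullet> A = b}"
    using assms by (auto simp: SO_SO_act_orbitope inner_SO_SO_act)
next
  fix B assume B: "B \<in> tautological_orbitope \<inter> {A. SO_SO_act g h N \<bullet> A = b}"
  let ?A = "SO_SO_act (transpose g) (transpose h) B"
  have eq: "B = SO_SO_act g h ?A"
    by (simp add: SO_SO_act_inverse assms)
  moreover have "?A \<in> tautological_orbitope"
    using B assms by (simp add: SO_SO_act_orbitope SO_group_transpose)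
  moreover have "N \<bullet> ?A = b"
    using B inner_SO_SO_act[OF assms, of N ?A] eq by simp
  ultimately show "B \<in> SO_SO_act g h ` (tautological_orbitope \<inter> {A. N \<bullet> A = b})"
    by blast
qed

lemma SO_SO_act_transport_face:
  "g \<in> SO_group \<Longrightarrow> h \<in> SO_group \<Longrightarrow>
    SO_SO_act g h ` transport_face u v = transport_face (g *v u) (h *v v)"
  by (simp add: transport_face_def SO_SO_act_exposed_face)
    (simp add: SO_SO_act_def matrix_mult_outer outer_matrix_mult del: transpose_matrix_vector)

lemma SO_SO_act_reflection_face:
  "g \<in> SO_group \<Longrightarrow> h \<in> SO_group \<Longrightarrow>
    SO_SO_act g h ` reflection_face R = reflection_face (SO_SO_act g h R)"
  by (simp add: reflection_face_def SO_SO_act_exposed_face)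

lemma SO_SO_orbit_transport_face:
  fixes u v :: "real^'n"
  assumes "CARD('n) \<ge> 2" "norm u = 1" "norm v = 1"
  shows "SO_SO_orbit (transport_face u v) = {transport_face x y |x y. norm x = 1 \<and> norm y = 1}"
proof (intro equalityI subsetI)
  fix F assume "F \<in> SO_SO_orbit (transport_face u v)"
  then obtain g h where gh: "g \<in> SO_group" "h \<in> SO_group" "F = SO_SO_act g h ` transport_face u v"
    by (auto simp: SO_SO_orbit_def)
  hence "norm (g *v u) = 1" "norm (h *v v) = 1" "F = transport_face (g *v u) (h *v v)"
    using assms by (auto simp: SO_SO_act_transport_face mem_SO_group orthogonal_matrix_norm)
  thus "F \<in> {transport_face x y |x y. norm x = 1 \<and> norm y = 1}"
    by blast
next
  fix F assume "F \<in> {transport_face x y |x y :: real^'n. norm x = 1 \<and> norm y = 1}"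
  then obtain x y :: "real^'n" where xy: "norm x = 1" "norm y = 1" "F = transport_face x y"
    by blast
  obtain g h where "g \<in> SO_group" "g *v u = x" "h \<in> SO_group" "h *v v = y"
    using exists_rotation_between_unit_vectors assms xy by metis
  hence "F = SO_SO_act g h ` transport_face u v" "g \<in> SO_group" "h \<in> SO_group"
    by (auto simp: SO_SO_act_transport_face xy)
  thus "F \<in> SO_SO_orbit (transport_face u v)"
    by (auto simp: SO_SO_orbit_def)
qed

lemma SO_SO_orbit_reflection_face:
  fixes R :: "real^'n^'n"
  assumes R: "rotoinversion_matrix R"
  shows "SO_SO_orbit (reflection_face R) = {reflection_face S |S. rotoinversion_matrix S}"
proof (intro equalityI subsetI)
  fix F assume "F \<in> SO_SO_orbit (reflection_face R)"
  then obtain g h where gh: "g \<in> SO_group" "h \<in> SO_group" "F = SO_SO_act g h ` reflection_face R"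
    by (auto simp: SO_SO_orbit_def)
  hence "rotoinversion_matrix (SO_SO_act g h R)"
    using R by (simp add: rotoinversion_matrix_def mem_SO_group SO_SO_act_def orthogonal_matrix_mul
        det_mul)
  with gh show "F \<in> {reflection_face S |S. rotoinversion_matrix S}"
    by (auto simp: SO_SO_act_reflection_face)
next
  fix F assume "F \<in> {reflection_face S |S :: real^'n^'n. rotoinversion_matrix S}"
  then obtain S :: "real^'n^'n" where S: "rotoinversion_matrix S" "F = reflection_face S"
    by blast
  let ?g = "S ** transpose R"
  have g: "?g \<in> SO_group"
    using R S by (simp add: mem_SO_group rotoinversion_matrix_def orthogonal_matrix_mul det_mul)
  have "transpose R ** R = mat 1"
    using R by (simp add: rotoinversion_matrix_def orthogonal_matrixD)
  hence "SO_SO_act ?g (mat 1) R = S"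
    by (simp add: SO_SO_act_def flip: matrix_mul_assoc)
  hence "F = SO_SO_act ?g (mat 1) ` reflection_face R"
    by (simp add: SO_SO_act_reflection_face g mat_1_SO_group S)
  thus "F \<in> SO_SO_orbit (reflection_face R)"
    using g mat_1_SO_group by (auto simp: SO_SO_orbit_def)
qed

section \<open>Affine types of the two families\<close>

lemma affine_image_convex_hull:
  assumes "linear f"
  shows "(\<lambda>x. f x + c) ` (convex hull S) = convex hull ((\<lambda>x. f x + c) ` S)"
proof -
  have "(\<lambda>x. f x + c) ` T = (\<lambda>x. c + x) ` (f ` T)" for T
    by (auto simp: image_image add.commute)
  thus ?thesis
    by (simp add: convex_hull_linear_image[OF assms] convex_hull_translation)
qed

text \<open>Multiplication by \<open>transpose R\<close> turns the rotations of the face into the reflections, and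
  \<open>H \<mapsto> (1 - H) / 2\<close> turns the reflections into the rank-one projections, whose hull is the free
  spectrahedron.\<close>

lemma affinely_isomorphic_reflection_face:
  fixes R :: "real^'n^'n"
  assumes R: "rotoinversion_matrix R"
  shows "affinely_isomorphic (reflection_face R) (free_spectrahedron :: (real^'n^'n) set)"
proof -
  have RR: "R ** transpose R = mat 1" "transpose R ** R = mat 1"
    using R by (auto simp: rotoinversion_matrix_def orthogonal_matrixD)
  define f where "f A = (- 1 / 2) *\<^sub>R (A ** transpose R)" for A :: "real^'n^'n"
  define c :: "real^'n^'n" where "c = (1 / 2) *\<^sub>R mat 1"
  have f: "linear f"
    unfolding f_def using linear_matrix_mult_right by (rule linear_compose_scale_right)
  have "inj_on (\<lambda>A. f A + c) (reflection_face R)"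
  proof (rule inj_onI)
    fix A B assume "f A + c = f B + c"
    hence "A ** transpose R = B ** transpose R"
      by (simp add: f_def)
    hence "A ** (transpose R ** R) = B ** (transpose R ** R)"
      by (simp add: matrix_mul_assoc)
    thus "A = B"
      by (simp add: RR)
  qed
  moreover have "f (householder w ** R) + c = outer w w" for w
  proof -
    have "householder w ** R ** transpose R = householder w"
      by (simp add: RR flip: matrix_mul_assoc)
    hence "f (householder w ** R) + c = (- 1 / 2) *\<^sub>R householder w + (1 / 2) *\<^sub>R mat 1"
      by (simp add: f_def c_def)
    thus ?thesis
      by (simp add: householder_def algebra_simps)
  qed
  hence "(\<lambda>A. f A + c) ` {householder w ** R |w. norm w = 1} = {outer w w |w. norm w = 1}"
    by (auto simp: image_iff) metis
  hence "(\<lambda>A. f A + c) ` reflection_face R = free_spectrahedron"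
    by (simp add: reflection_face_eq_hull[OF R] affine_image_convex_hull[OF f]
        free_spectrahedron_eq_convex_hull)
  ultimately show ?thesis
    using f unfolding affinely_isomorphic_def bij_betw_def by blast
qed

definition principal_submatrix :: "('m \<Rightarrow> 'n) \<Rightarrow> 'a^'n^'n \<Rightarrow> 'a^'m^'m" where
  "principal_submatrix \<phi> A = (\<chi> i j. A $ \<phi> i $ \<phi> j)"

lemma sum_UNIV_split_point:
  fixes \<phi> :: "'m::finite \<Rightarrow> 'n::finite"
  assumes "bij_betw \<phi> UNIV (UNIV - {k})"
  shows "(\<Sum>i\<in>UNIV. f i) = f k + (\<Sum>i\<in>UNIV. f (\<phi> i))"
  using sum.reindex_bij_betw[OF assms, of f] by (simp add: sum.remove[of UNIV k])

text \<open>In the Leibniz formula only the permutations fixing \<open>k\<close> contribute, and these correspond to the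
  permutations of the smaller index type, with the same signs.\<close>

lemma det_principal_submatrix:
  fixes A :: "real^'n^'n" and \<phi> :: "'m::finite \<Rightarrow> 'n"
  assumes \<phi>: "bij_betw \<phi> UNIV (UNIV - {k})" and row: "\<And>j. A $ k $ j = (if j = k then 1 else 0)"
  shows "det (principal_submatrix \<phi> A) = det A"
proof -
  let ?m = "map_permutation UNIV \<phi>"
  let ?P = "{p. p permutes (UNIV - {k})}"
  have inj: "inj \<phi>"
    using \<phi> by (simp add: bij_betw_def)
  have bij: "bij_betw ?m {q. q permutes UNIV} ?P"
  proof -
    have "range \<phi> = UNIV - {k}"
      using \<phi> by (simp add: bij_betw_def)
    hence "?m = (\<lambda>q x. if x \<in> UNIV - {k} then \<phi> (q (inv \<phi> x)) else x)"
      by (auto simp: fun_eq_iff map_permutation_def restrict_id_def)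
    thus ?thesis
      using bij_betw_permutations[OF \<phi>] by simp
  qed
  have "det A = (\<Sum>p\<in>?P. of_int (sign p) * (\<Prod>i\<in>UNIV. A $ i $ p i))"
    unfolding det_def
  proof (rule sum.mono_neutral_right)
    show "?P \<subseteq> {p. p permutes UNIV}"
      by (auto intro: permutes_subset)
    show "\<forall>p\<in>{p. p permutes UNIV} - ?P. of_int (sign p) * (\<Prod>i\<in>UNIV. A $ i $ p i) = 0"
    proof
      fix p assume p: "p \<in> {p. p permutes UNIV} - ?P"
      hence "p k \<noteq> k"
        using permutes_superset[of p UNIV "UNIV - {k}"] by auto
      hence "A $ k $ p k = 0"
        by (simp add: row)
      hence "(\<Prod>i\<in>UNIV. A $ i $ p i) = 0"
        by (intro prod_zero) auto
      thus "of_int (sign p) * (\<Prod>i\<in>UNIV. A $ i $ p i) = 0"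
        by simp
    qed
  qed (simp add: finite_permutations)
  also have "\<dots> = (\<Sum>q | q permutes UNIV. of_int (sign (?m q)) * (\<Prod>i\<in>UNIV. A $ i $ ?m q i))"
    by (rule sum.reindex_bij_betw[OF bij, symmetric])
  also have "\<dots> = (\<Sum>q | q permutes UNIV. of_int (sign q)
      * (\<Prod>i\<in>UNIV. principal_submatrix \<phi> A $ i $ q i))"
  proof (rule sum.cong)
    fix q :: "'m \<Rightarrow> 'm" assume "q \<in> {q. q permutes UNIV}"
    hence q: "q permutes UNIV"
      by simp
    have mk: "?m q k = k"
      using map_permutation_permutes[OF \<phi> q] by (simp add: permutes_def)
    have "(\<Prod>i\<in>UNIV. A $ i $ ?m q i) = (\<Prod>i\<in>UNIV - {k}. A $ i $ ?m q i)"
      using mk by (simp add: prod.remove[of UNIV k] row)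
    also have "\<dots> = (\<Prod>i\<in>UNIV. A $ \<phi> i $ ?m q (\<phi> i))"
      by (rule prod.reindex_bij_betw[OF \<phi>, symmetric])
    also have "\<dots> = (\<Prod>i\<in>UNIV. principal_submatrix \<phi> A $ i $ q i)"
      using map_permutation_apply[OF inj] by (simp add: principal_submatrix_def)
    finally show "of_int (sign (?m q)) * (\<Prod>i\<in>UNIV. A $ i $ ?m q i)
        = of_int (sign q) * (\<Prod>i\<in>UNIV. principal_submatrix \<phi> A $ i $ q i)"
      using sign_map_permutation[OF inj q] by simp
  qed simp
  finally show ?thesis
    by (simp add: det_def)
qed

lemma SO_group_principal_submatrix_iff:
  fixes A :: "real^'n^'n" and \<phi> :: "'m::finite \<Rightarrow> 'n"
  assumes \<phi>: "bij_betw \<phi> UNIV (UNIV - {k})"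
    and row: "\<And>j. A $ k $ j = (if j = k then 1 else 0)"
    and col: "\<And>i. A $ i $ k = (if i = k then 1 else 0)"
  shows "principal_submatrix \<phi> A \<in> SO_group \<longleftrightarrow> A \<in> SO_group"
proof -
  let ?B = "principal_submatrix \<phi> A"
  have \<phi>k: "\<phi> i \<noteq> k" "k \<noteq> \<phi> i" for i
    using \<phi> by (auto simp: bij_betw_def)
  have \<phi>_eq: "\<phi> i = \<phi> j \<longleftrightarrow> i = j" for i j
    using \<phi> by (auto simp: bij_betw_def inj_eq)
  have cases: "(\<forall>i. P i) \<longleftrightarrow> P k \<and> (\<forall>i. P (\<phi> i))" for P
  proof -
    have "insert k (range \<phi>) = UNIV"
      using \<phi> by (auto simp: bij_betw_def)
    thus ?thesis
      by (metis UNIV_I insertE rangeE)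
  qed
  have "A $ k \<bullet> A $ k = 1" "A $ k \<bullet> A $ \<phi> i = 0" "A $ \<phi> i \<bullet> A $ k = 0"
    "A $ \<phi> i \<bullet> A $ \<phi> j = ?B $ i \<bullet> ?B $ j" for i j
    by (simp_all add: inner_vec_def sum_UNIV_split_point[OF \<phi>] row col \<phi>k principal_submatrix_def)
  moreover let ?Q = "\<lambda>i j. A $ i \<bullet> A $ j = (if i = j then 1 else 0)"
  have "(\<forall>i j. ?Q i j) \<longleftrightarrow>
      (?Q k k \<and> (\<forall>j. ?Q k (\<phi> j))) \<and> (\<forall>i. ?Q (\<phi> i) k \<and> (\<forall>j. ?Q (\<phi> i) (\<phi> j)))"
    unfolding cases[of "\<lambda>i. \<forall>j. ?Q i j"] cases[of "?Q k"] cases[of "?Q (\<phi> i)" for i] ..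
  ultimately have "orthogonal_matrix A \<longleftrightarrow> orthogonal_matrix ?B"
    unfolding orthogonal_matrix_rows_inner by (simp add: \<phi>k \<phi>_eq)
  thus ?thesis
    by (simp add: mem_SO_group det_principal_submatrix[OF \<phi> row])
qed

text \<open>The claim about the row holds because the inverse \<open>transpose g\<close> fixes the same vector.\<close>

lemma SO_group_fixing_axis:
  fixes g :: "real^'n^'n"
  assumes "g \<in> SO_group" "g *v axis k 1 = axis k 1"
  shows "g $ k $ j = (if j = k then 1 else 0)" "g $ i $ k = (if i = k then 1 else 0)"
proof -
  have "transpose g *v axis k 1 = axis k 1"
    using assms orthogonal_matrix_cancel(1)[of g "axis k 1"] by (simp only: mem_SO_group)
  hence "row k g = axis k 1"
    by (simp only: matrix_vector_mult_basis column_transpose)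
  thus "g $ k $ j = (if j = k then 1 else 0)"
    by (simp add: row_def axis_def vec_eq_iff)
  have "column k g = axis k 1"
    using assms(2) by (simp only: matrix_vector_mult_basis)
  thus "g $ i $ k = (if i = k then 1 else 0)"
    by (simp add: column_def axis_def vec_eq_iff)
qed

lemma principal_submatrix_SO_group_stabilizer:
  fixes \<phi> :: "'m::finite \<Rightarrow> 'n::finite"
  assumes \<phi>: "bij_betw \<phi> UNIV (UNIV - {k})"
  shows "principal_submatrix \<phi> ` {g \<in> SO_group. g *v axis k 1 = axis k 1}
    = (SO_group :: (real^'m^'m) set)"
proof (intro equalityI subsetI)
  fix B assume "B \<in> principal_submatrix \<phi> ` {g :: real^'n^'n. g \<in> SO_group \<and> g *v axis k 1 = axis k 1}"
  then obtain g :: "real^'n^'n" where g: "g \<in> SO_group" "g *v axis k 1 = axis k 1"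
    "B = principal_submatrix \<phi> g"
    by blast
  thus "B \<in> SO_group"
    using SO_group_principal_submatrix_iff[OF \<phi> SO_group_fixing_axis[OF g(1,2)]] by simp
next
  fix B :: "real^'m^'m" assume B: "B \<in> SO_group"
  define g :: "real^'n^'n" where
    "g = (\<chi> i j. if i = k \<or> j = k then if i = j then 1 else 0 else B $ inv \<phi> i $ inv \<phi> j)"
  have "\<phi> i \<noteq> k" "inv \<phi> (\<phi> i) = i" for i
    using \<phi> by (auto simp: bij_betw_def)
  hence gB: "principal_submatrix \<phi> g = B"
    by (simp add: principal_submatrix_def g_def vec_eq_iff)
  have "g $ k $ j = (if j = k then 1 else 0)" "g $ j $ k = (if j = k then 1 else 0)" for j
    by (auto simp: g_def)
  hence "g \<in> SO_group"
    using SO_group_principal_submatrix_iff[OF \<phi>, of g] gB B by simp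
  moreover have "g *v axis k 1 = axis k 1"
    unfolding matrix_vector_mult_basis by (auto simp: column_def axis_def vec_eq_iff g_def)
  ultimately show "B \<in> principal_submatrix \<phi> ` {g \<in> SO_group. g *v axis k 1 = axis k 1}"
    using gB by blast
qed

lemma transport_face_axis_entries:
  assumes "A \<in> transport_face (axis k 1) (axis k 1)"
  shows "A $ k $ j = (if j = k then 1 else 0) \<and> A $ j $ k = (if j = k then 1 else 0)"
proof -
  let ?S = "{A :: real^'a^'a. \<forall>j. A $ k $ j = (if j = k then 1 else 0) \<and> A $ j $ k = (if j = k then 1 else 0)}"
  have "convex ?S"
    by (rule convexI) auto
  moreover have "{g \<in> SO_group. g *v axis k 1 = axis k 1} \<subseteq> ?S"
    using SO_group_fixing_axis by blast
  ultimately have "transport_face (axis k 1) (axis k 1) \<subseteq> ?S"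
    by (simp add: transport_face_eq_hull hull_minimal)
  thus ?thesis
    using assms by blast
qed

text \<open>A rotation fixing a coordinate vector is a rotation of the remaining coordinates; an arbitrary
  transport face is first moved by the group action to one belonging to a coordinate vector.\<close>

lemma affinely_isomorphic_transport_face:
  fixes u v :: "real^'n"
  assumes n: "CARD('n) \<ge> 2" "CARD('n) = CARD('m::finite) + 1" and uv: "norm u = 1" "norm v = 1"
  shows "affinely_isomorphic (transport_face u v) (tautological_orbitope :: (real^'m^'m) set)"
proof -
  define k :: 'n where "k = undefined"
  let ?e = "axis k 1 :: real^'n"
  have "card (UNIV :: 'm set) = card (UNIV - {k})"
    using n by simp
  then obtain \<phi> :: "'m \<Rightarrow> 'n" where \<phi>: "bij_betw \<phi> UNIV (UNIV - {k})"
    using finite_same_card_bij[of "UNIV :: 'm set" "UNIV - {k}"] by auto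
  obtain g h where gh: "g \<in> SO_group" "g *v u = ?e" "h \<in> SO_group" "h *v v = ?e"
    using exists_rotation_between_unit_vectors[OF n(1)] uv norm_axis_1 by metis
  define f where "f A = principal_submatrix \<phi> (SO_SO_act g h A)" for A
  have lin: "linear (principal_submatrix \<phi> :: real^'n^'n \<Rightarrow> real^'m^'m)"
    by (rule linearI) (simp_all add: principal_submatrix_def vec_eq_iff)
  have f: "linear f"
    using linear_compose[OF linear_SO_SO_act lin, of g h] by (simp add: f_def[abs_def] o_def)
  have act: "SO_SO_act g h ` transport_face u v = transport_face ?e ?e"
    by (simp add: SO_SO_act_transport_face gh)
  have "inj_on (principal_submatrix \<phi>) (transport_face ?e ?e)"
  proof (rule inj_onI)
    fix A B assume A: "A \<in> transport_face ?e ?e" and B: "B \<in> transport_face ?e ?e"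
      and eq: "principal_submatrix \<phi> A = principal_submatrix \<phi> B"
    have "A $ i $ j = B $ i $ j" for i j
    proof (cases "i = k \<or> j = k")
      case True
      thus ?thesis
        using transport_face_axis_entries[OF A] transport_face_axis_entries[OF B] by auto
    next
      case False
      hence "i \<in> range \<phi>" "j \<in> range \<phi>"
        using \<phi> by (auto simp: bij_betw_def)
      then obtain a b where "i = \<phi> a" "j = \<phi> b"
        by blast
      thus ?thesis
        using eq by (simp add: principal_submatrix_def vec_eq_iff)
    qed
    thus "A = B"
      by (simp add: vec_eq_iff)
  qed
  moreover have "inj_on (SO_SO_act g h) (transport_face u v)"
    by (metis SO_SO_act_inverse(1) gh(1,3) inj_onI)
  ultimately have "inj_on f (transport_face u v)"
    unfolding f_def using comp_inj_on[of "SO_SO_act g h" _ "principal_submatrix \<phi>"] act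
    by (simp add: o_def)
  moreover have "f ` transport_face u v = principal_submatrix \<phi> ` transport_face ?e ?e"
    unfolding act[symmetric] by (simp add: f_def image_image)
  hence "f ` transport_face u v = tautological_orbitope"
    by (simp add: transport_face_eq_hull convex_hull_linear_image[OF lin]
        principal_submatrix_SO_group_stabilizer[OF \<phi>] tautological_orbitope_def)
  ultimately have "bij_betw (\<lambda>A. f A + 0) (transport_face u v) tautological_orbitope"
    by (simp add: bij_betw_def)
  with f show ?thesis
    unfolding affinely_isomorphic_def by blast
qed

theorem theorem4p11:
  assumes "CARD('n::finite) \<ge> 4"
    and "CARD('n) = CARD('m::finite) + 1"
  shows "(\<exists>\<O>\<^sub>1 \<O>\<^sub>2. (facet_orbits :: (real^'n^'n) set set set) = {\<O>\<^sub>1, \<O>\<^sub>2} \<and> \<O>\<^sub>1 \<noteq> \<O>\<^sub>2 \<and>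
           (\<forall>F\<in>\<O>\<^sub>1. affinely_isomorphic F (tautological_orbitope :: (real^'m^'m) set)) \<and>
           (\<forall>F\<in>\<O>\<^sub>2. affinely_isomorphic F (free_spectrahedron :: (real^'n^'n) set))) \<and>
         aff_dim (free_spectrahedron :: (real^'n^'n) set) = int ((CARD('n) + 1) choose 2) - 1"
proof (intro conjI exI)
  define T where "T = {transport_face u v |u v :: real^'n. norm u = 1 \<and> norm v = 1}"
  define R where "R = {reflection_face S |S :: real^'n^'n. rotoinversion_matrix S}"
  have n2: "CARD('n) \<ge> 2"
    using assms(1) by simp
  let ?e = "axis undefined 1 :: real^'n"
  have eT: "transport_face ?e ?e \<in> T"
    by (auto simp: T_def intro!: exI[of _ ?e])
  obtain S :: "real^'n^'n" where S: "rotoinversion_matrix S"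
    using rotoinversion_exists by blast
  have max: "maximal_facet F tautological_orbitope \<longleftrightarrow> F \<in> T \<or> F \<in> R" for F :: "(real^'n^'n) set"
    unfolding maximal_facet_orbitope_iff[OF assms(1)] T_def R_def by blast
  have orbit_T: "SO_SO_orbit F = T" if "F \<in> T" for F
    using that SO_SO_orbit_transport_face[OF n2] unfolding T_def by blast
  have orbit_R: "SO_SO_orbit F = R" if "F \<in> R" for F
    using that SO_SO_orbit_reflection_face unfolding R_def by blast
  have SR: "reflection_face S \<in> R"
    using S by (auto simp: R_def)
  show "facet_orbits = {T, R}"
  proof (intro equalityI subsetI)
    fix X assume "X \<in> (facet_orbits :: (real^'n^'n) set set set)"
    thus "X \<in> {T, R}"
      by (auto simp: facet_orbits_def max orbit_T orbit_R)
  next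
    fix X assume "X \<in> {T, R}"
    thus "X \<in> facet_orbits"
      using orbit_T[OF eT] orbit_R[OF SR] eT SR unfolding facet_orbits_def max by blast
  qed
  show "T \<noteq> R"
    using eT transport_face_not_subset_reflection_face[OF assms(1), of ?e ?e]
    by (auto simp: R_def)
  show "\<forall>F\<in>T. affinely_isomorphic F (tautological_orbitope :: (real^'m^'m) set)"
    using affinely_isomorphic_transport_face[OF n2 assms(2)] by (auto simp: T_def)
  show "\<forall>F\<in>R. affinely_isomorphic F (free_spectrahedron :: (real^'n^'n) set)"
    using affinely_isomorphic_reflection_face by (auto simp: R_def)
  show "aff_dim (free_spectrahedron :: (real^'n^'n) set) = int ((CARD('n) + 1) choose 2) - 1"
    by (rule aff_dim_free_spectrahedron)
qed

end
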